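(* Let $t\in[n]$. Let $|\psi\rangle$ be an $n$-qubit pure quantum state and let $\lambda_1\le\dots\le\lambda_n$ be the normal eigenvalues of its correlation matrix, in increasing order. Then there exists a $t$-compressible Gaussian state $|\psi_t\rangle$ such that $$d_{\mathrm{tr}}(|\psi_t\rangle,|\psi\rangle)\ \le\ \sqrt{\sum_{k=t+1}^{n}\frac12(1-\lambda_k)}.$$ In particular, $|\psi_t\rangle$ can be chosen as $|\psi_t\rangle:=G_O(|\phi\rangle\otimes|0^{n-t}\rangle)$, where $G_O$ is the Gaussian unitary associated with the orthogonal matrix $O\in\mathrm{O}(2n)$ that puts the correlation matrix of $|\psi\rangle$ in its normal form, and $|\phi\rangle\otimes|0^{n-t}\rangle$ is the state obtained by projecting the state $G_O^\dagger|\psi\rangle$ onto the zero state on the last $n-t$ qubits.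
   Context: On $n$ qubits with Pauli operators $X_k,Y_k,Z_k$, the Majorana operators are $\gamma_{2k-1}:=(\prod_{j=1}^{k-1}Z_j)X_k$ and $\gamma_{2k}:=(\prod_{j=1}^{k-1}Z_j)Y_k$, $k\in[n]:=\{1,\dots,n\}$. A Gaussian unitary is a unitary $G$ for which there is $O\in\mathrm{O}(2n)$ with $G^\dagger\gamma_\mu G=\sum_{\nu=1}^{2n}O_{\mu,\nu}\gamma_\nu$ for all $\mu\in[2n]$; it is determined by $O$ up to a phase and denoted $G_O$. A pure state is a $t$-compressible Gaussian state if it equals $G(|\phi\rangle\otimes|0^{n-t}\rangle)$ with $G$ a Gaussian unitary and $|\phi\rangle$ a pure state on the first $t$ qubits. The trace distance is $d_{\mathrm{tr}}(\rho,\sigma)=\frac12\|\rho-\sigma\|_1$, applied to pure states via their density matrices. The correlation matrix of a state $\rho$ is the real antisymmetric matrix $[C(\rho)]_{j,k}=-\frac i2\mathrm{Tr}([\gamma_j,\gamma_k]\rho)$, $j,k\in[2n]$. A normal form of a real antisymmetric $2n\times2n$ matrix $C$ is $C=O\bigoplus_{j=1}^n\begin{pmatrix}0&\lambda_j\\-\lambda_j&0\end{pmatrix}O^T$ with $O\in\mathrm{O}(2n)$ and normal eigenvalues $0\le\lambda_1\le\dots\le\lambda_n$. The state obtained by projecting means the normalized post-measurement state.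
   Formalization: The explicit choice of the state is asserted for every normal-form O and associated Gaussian unitary for which projecting onto the zero state on the last n−t qubits has nonzero probability, since otherwise the normalized projected state is undefined; the existence claim has no such condition. *)

theory Defs
  imports "Jordan_Normal_Form.Schur_Decomposition"
begin

text \<open>
  Operators on n qubits are complex matrices of size \<open>2 ^ n\<close>, pure states are unit vectors.
  Matrix, qubit and Majorana indices start at 0, so that \<open>majorana n \<mu>\<close> is the operator
  usually written \<open>\<gamma>\<close> with index \<open>\<mu> + 1\<close>.
\<close>

text \<open>The first tensor factor carries the most significant digits of the index.\<close>

definition kron :: "complex mat \<Rightarrow> complex mat \<Rightarrow> complex mat" (infixr \<open>\<otimes>\<^sub>k\<close> 75) where
  "A \<otimes>\<^sub>k B = mat (dim_row A * dim_row B) (dim_col A * dim_col B)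
     (\<lambda>(i, j). A $$ (i div dim_row B, j div dim_col B) * B $$ (i mod dim_row B, j mod dim_col B))"

definition kron_vec :: "complex vec \<Rightarrow> complex vec \<Rightarrow> complex vec" (infixr \<open>\<otimes>\<^sub>s\<close> 75) where
  "v \<otimes>\<^sub>s w = vec (dim_vec v * dim_vec w)
     (\<lambda>i. v $ (i div dim_vec w) * w $ (i mod dim_vec w))"

definition mat_trace :: "complex mat \<Rightarrow> complex" where
  "mat_trace A = (\<Sum>i<dim_row A. A $$ (i, i))"

definition unitary_mat :: "nat \<Rightarrow> complex mat \<Rightarrow> bool" where
  "unitary_mat d U \<longleftrightarrow> U \<in> carrier_mat d d
     \<and> mat_adjoint U * U = 1\<^sub>m d \<and> U * mat_adjoint U = 1\<^sub>m d"

text \<open>The library's \<open>orthogonal_mat\<close> only asks for nonzero pairwise orthogonal columns.\<close>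

definition orthogonal_group :: "nat \<Rightarrow> real mat set" where
  "orthogonal_group d = {Q \<in> carrier_mat d d. Q\<^sup>T * Q = 1\<^sub>m d \<and> Q * Q\<^sup>T = 1\<^sub>m d}"

definition pure_state :: "nat \<Rightarrow> complex vec \<Rightarrow> bool" where
  "pure_state n v \<longleftrightarrow> v \<in> carrier_vec (2 ^ n) \<and> v \<bullet>c v = 1"

definition ket_zeros :: "nat \<Rightarrow> complex vec" where
  "ket_zeros m = unit_vec (2 ^ m) 0"

definition ketbra :: "complex vec \<Rightarrow> complex mat" where
  "ketbra v = mat (dim_vec v) (dim_vec v) (\<lambda>(i, j). v $ i * cnj (v $ j))"

text \<open>The sum of the singular values of \<open>A\<close>, that is, of the square roots of the eigenvalues
  of \<open>mat_adjoint A * A\<close>, counted with algebraic multiplicity.  These eigenvalues are real and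
  nonnegative, so \<open>Re\<close> is only a type conversion.\<close>

definition trace_norm :: "complex mat \<Rightarrow> real" where
  "trace_norm A = (let p = char_poly (mat_adjoint A * A) in
     \<Sum>x | poly p x = 0. real (order x p) * sqrt (Re x))"

definition trace_distance :: "complex mat \<Rightarrow> complex mat \<Rightarrow> real" where
  "trace_distance \<rho> \<sigma> = 1 / 2 * trace_norm (\<rho> - \<sigma>)"

definition pauli_X :: "complex mat" where
  "pauli_X = mat_of_rows_list 2 [[0, 1], [1, 0]]"

definition pauli_Y :: "complex mat" where
  "pauli_Y = mat_of_rows_list 2 [[0, - \<i>], [\<i>, 0]]"

definition pauli_Z :: "complex mat" where
  "pauli_Z = mat_of_rows_list 2 [[1, 0], [0, - 1]]"

definition on_qubit :: "nat \<Rightarrow> nat \<Rightarrow> complex mat \<Rightarrow> complex mat" where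
  "on_qubit n k P = 1\<^sub>m (2 ^ k) \<otimes>\<^sub>k P \<otimes>\<^sub>k 1\<^sub>m (2 ^ (n - k - 1))"

definition Z_string :: "nat \<Rightarrow> nat \<Rightarrow> complex mat" where
  "Z_string n k = foldr (*) (map (\<lambda>j. on_qubit n j pauli_Z) [0..<k]) (1\<^sub>m (2 ^ n))"

definition majorana :: "nat \<Rightarrow> nat \<Rightarrow> complex mat" where
  "majorana n \<mu> = Z_string n (\<mu> div 2)
     * on_qubit n (\<mu> div 2) (if even \<mu> then pauli_X else pauli_Y)"

text \<open>The entrywise form of \<open>\<Sum>\<nu><2*n. Q $$ (\<mu>, \<nu>) \<cdot> \<gamma>\<^sub>\<nu>\<close>; matrices of unspecified dimension
  do not form a monoid, so the library's \<open>sum\<close> is not available on them.\<close>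

definition majorana_comb :: "nat \<Rightarrow> real mat \<Rightarrow> nat \<Rightarrow> complex mat" where
  "majorana_comb n Q \<mu> = mat (2 ^ n) (2 ^ n)
     (\<lambda>(a, b). \<Sum>\<nu><2 * n. complex_of_real (Q $$ (\<mu>, \<nu>)) * majorana n \<nu> $$ (a, b))"

definition gaussian_unitary_of :: "nat \<Rightarrow> real mat \<Rightarrow> complex mat \<Rightarrow> bool" where
  "gaussian_unitary_of n Q G \<longleftrightarrow> Q \<in> orthogonal_group (2 * n) \<and> unitary_mat (2 ^ n) G
     \<and> (\<forall>\<mu><2 * n. mat_adjoint G * majorana n \<mu> * G = majorana_comb n Q \<mu>)"

definition gaussian_unitary :: "nat \<Rightarrow> complex mat \<Rightarrow> bool" where
  "gaussian_unitary n G \<longleftrightarrow> (\<exists>Q. gaussian_unitary_of n Q G)"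

definition compressible_gaussian_state :: "nat \<Rightarrow> nat \<Rightarrow> complex vec \<Rightarrow> bool" where
  "compressible_gaussian_state n t v \<longleftrightarrow>
     (\<exists>G \<phi>. gaussian_unitary n G \<and> pure_state t \<phi> \<and> v = G *\<^sub>v (\<phi> \<otimes>\<^sub>s ket_zeros (n - t)))"

text \<open>For Hermitian \<open>\<rho>\<close> the expression under \<open>Re\<close> is already real.\<close>

definition correlation_matrix :: "nat \<Rightarrow> complex mat \<Rightarrow> real mat" where
  "correlation_matrix n \<rho> = mat (2 * n) (2 * n) (\<lambda>(j, k).
     Re (- \<i> / 2 * mat_trace
       ((majorana n j * majorana n k - majorana n k * majorana n j) * \<rho>)))"

text \<open>The numbers \<open>lam 1, \<dots>, lam n\<close> keep their usual indices 1 to n.\<close>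

definition normal_block :: "nat \<Rightarrow> (nat \<Rightarrow> real) \<Rightarrow> real mat" where
  "normal_block n lam =
     diag_block_mat (map (\<lambda>j. mat_of_rows_list 2 [[0, lam j], [- lam j, 0]]) [1..<n + 1])"

definition normal_form :: "nat \<Rightarrow> real mat \<Rightarrow> real mat \<Rightarrow> (nat \<Rightarrow> real) \<Rightarrow> bool" where
  "normal_form n C Q lam \<longleftrightarrow> Q \<in> orthogonal_group (2 * n)
     \<and> (\<forall>j\<in>{1..n}. 0 \<le> lam j) \<and> mono_on {1..n} lam
     \<and> C = Q * normal_block n lam * Q\<^sup>T"

definition normal_eigenvalues :: "nat \<Rightarrow> real mat \<Rightarrow> (nat \<Rightarrow> real) \<Rightarrow> bool" where
  "normal_eigenvalues n C lam \<longleftrightarrow> (\<exists>Q. normal_form n C Q lam)"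

definition zero_projector :: "nat \<Rightarrow> nat \<Rightarrow> complex mat" where
  "zero_projector n t = 1\<^sub>m (2 ^ t) \<otimes>\<^sub>k ketbra (ket_zeros (n - t))"

definition outcome_prob :: "complex mat \<Rightarrow> complex vec \<Rightarrow> real" where
  "outcome_prob P v = Re ((P *\<^sub>v v) \<bullet>c (P *\<^sub>v v))"

text \<open>Meaningful only for an outcome of positive probability.\<close>

definition post_measurement :: "complex mat \<Rightarrow> complex vec \<Rightarrow> complex vec" where
  "post_measurement P v = complex_of_real (1 / sqrt (outcome_prob P v)) \<cdot>\<^sub>v (P *\<^sub>v v)"

end

theory Submission
  imports Defs
begin

text \<open>
  The orthogonal matrix \<open>Q\<close> is a product of reflections.  The reflection in a unit vector \<open>v\<close> is
  implemented by \<open>\<gamma>(v)\<close> times the parity operator, so \<open>Q\<close> comes from a Gaussian unitary \<open>G\<close>.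
  The correlation matrix of \<open>G\<^sup>\<dagger>\<psi>\<close> is the normal block matrix, so the expectation of \<open>Z\<close> on qubit
  \<open>k\<close> is \<open>lam k\<close>, and by the union bound the projection onto zero on the last \<open>n - t\<close> qubits succeeds
  with probability \<open>p\<close>, \<open>1 - p \<le> (\<Sum>k = t + 1..n. (1 - lam k) / 2)\<close>.  The squared overlap
  of the projected state with \<open>G\<^sup>\<dagger>\<psi>\<close> is \<open>p\<close>, so the trace distance is \<open>sqrt (1 - p)\<close>.
\<close>

section \<open>Adjoints, traces and the trace distance of pure states\<close>

text \<open>The estimate has to hold for every \<open>G\<close> that implements \<open>Q\<close>, so
  it may use only the conjugation relation; the product of reflections serves existence alone.
  Correlation matrix and measurement meet in
  \<open>majorana n (2 * k) * majorana n (2 * k + 1)\<close>, which is \<i> times Z on qubit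
  \<open>k\<close>. As these Z operators and the projector are diagonal, probabilities become sums
  of squared amplitudes, and events become conditions on the binary digits of the basis index. The
  overlap is sqrt p because <Pv, v> = <Pv, Pv> = p for the projector P, and normalizing divides by
  sqrt p. Two obstacles shape the proof. The trace norm is a sum over the roots of a characteristic
  polynomial; instead of diagonalizing, the proof confines these roots to two values and compares
  with the trace, which Schur decomposition identifies with their sum. And for p = 0 there is no
  projected state; the bound is then at least 1, so that any compressible state will do.\<close>

lemma index_mat_adjoint [simp]:
  "i < dim_col A \<Longrightarrow> j < dim_row A \<Longrightarrow> mat_adjoint (A :: complex mat) $$ (i, j) = cnj (A $$ (j, i))"
  "dim_row (mat_adjoint A) = dim_col A" "dim_col (mat_adjoint A) = dim_row A"
  unfolding mat_adjoint_def by (auto simp: mat_of_rows_def)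

lemma mat_adjoint_carrier [simp]:
  "(A :: complex mat) \<in> carrier_mat r c \<Longrightarrow> mat_adjoint A \<in> carrier_mat c r"
  by (metis carrier_matD carrier_matI index_mat_adjoint(2,3))

lemma mat_adjoint_adjoint [simp]: "mat_adjoint (mat_adjoint A) = (A :: complex mat)"
  by (rule eq_matI) auto

lemma mat_adjoint_one [simp]: "mat_adjoint (1\<^sub>m d) = (1\<^sub>m d :: complex mat)"
  by (rule eq_matI) auto

lemma mat_adjoint_mult:
  assumes "(A :: complex mat) \<in> carrier_mat r m" "B \<in> carrier_mat m c"
  shows "mat_adjoint (A * B) = mat_adjoint B * mat_adjoint A"
  using assms by (intro eq_matI) (auto simp: scalar_prod_def cnj_sum mult.commute intro!: sum.cong)

lemma cscalar_prod_eq_sum: "v \<bullet>c w = (\<Sum>i<dim_vec w. v $ i * cnj (w $ i))"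
  by (auto simp: scalar_prod_def lessThan_atLeast0 intro!: sum.cong)

lemma mat_mult_index_sum:
  "i < dim_row A \<Longrightarrow> j < dim_col B \<Longrightarrow> dim_col A = dim_row B \<Longrightarrow>
    (A * B) $$ (i, j) = (\<Sum>k<dim_row B. A $$ (i, k) * B $$ (k, j))"
  by (auto simp: scalar_prod_def lessThan_atLeast0 intro!: sum.cong)

lemma mat_vec_index_sum:
  "dim_col A = dim_vec v \<Longrightarrow> i < dim_row A \<Longrightarrow> (A *\<^sub>v v) $ i = (\<Sum>k<dim_vec v. A $$ (i, k) * v $ k)"
  by (auto simp: scalar_prod_def lessThan_atLeast0 intro!: sum.cong)

lemma cscalar_prod_adjoint:
  assumes "(A :: complex mat) \<in> carrier_mat r c" "v \<in> carrier_vec c" "w \<in> carrier_vec r"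
  shows "(A *\<^sub>v v) \<bullet>c w = v \<bullet>c (mat_adjoint A *\<^sub>v w)"
proof -
  have "(A *\<^sub>v v) \<bullet>c w = (\<Sum>i<r. \<Sum>k<c. A $$ (i, k) * v $ k * cnj (w $ i))"
    using assms by (auto simp: cscalar_prod_eq_sum mat_vec_index_sum sum_distrib_right simp del: index_mult_mat_vec intro!: sum.cong)
  also have "\<dots> = (\<Sum>k<c. \<Sum>i<r. A $$ (i, k) * v $ k * cnj (w $ i))" by (rule sum.swap)
  also have "\<dots> = v \<bullet>c (mat_adjoint A *\<^sub>v w)"
    using assms by (auto simp: cscalar_prod_eq_sum mat_vec_index_sum sum_distrib_left cnj_sum mult_ac simp del: index_mult_mat_vec intro!: sum.cong)
  finally show ?thesis .
qed

section \<open>Traces and trace norms through eigenvalues\<close>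

lemma mat_trace_comm:
  assumes "A \<in> carrier_mat r c" "B \<in> carrier_mat c r"
  shows "mat_trace (A * B) = mat_trace (B * A)"
proof -
  have "mat_trace (A * B) = (\<Sum>i<r. \<Sum>j<c. A $$ (i, j) * B $$ (j, i))"
    using assms by (auto simp: mat_trace_def mat_mult_index_sum simp del: index_mult_mat(1) intro!: sum.cong)
  also have "\<dots> = (\<Sum>j<c. \<Sum>i<r. A $$ (i, j) * B $$ (j, i))" by (rule sum.swap)
  also have "\<dots> = mat_trace (B * A)"
    using assms by (auto simp: mat_trace_def mat_mult_index_sum mult.commute simp del: index_mult_mat(1) intro!: sum.cong)
  finally show ?thesis .
qed

text \<open>Schur decomposition makes \<open>A\<close> similar to a triangular matrix with diagonal
  \<open>as\<close>, and cyclicity makes the trace a similarity invariant. A trace computed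
  entrywise thus gives the sum of the roots over which \<open>trace_norm\<close> runs.\<close>

lemma mat_trace_eq_sum_roots:
  assumes A: "A \<in> carrier_mat d d" and cp: "char_poly A = (\<Prod>a\<leftarrow>as. [:- a, 1:])"
  shows "mat_trace A = sum_list as"
proof -
  obtain B P Q where s: "schur_decomposition A as = (B, P, Q)" by (cases "schur_decomposition A as") auto
  from schur_decomposition[OF A cp s] have sim: "similar_mat_wit A B P Q" and dB: "diag_mat B = as" by auto
  from similar_mat_witD2[OF A sim] have *: "Q * P = 1\<^sub>m d" "A = P * B * Q" "B \<in> carrier_mat d d"
     "P \<in> carrier_mat d d" "Q \<in> carrier_mat d d" by auto
  have "mat_trace A = mat_trace (Q * (P * B))"
    unfolding *(2) by (rule mat_trace_comm[of _ d d]) (use * in auto)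
  also have "Q * (P * B) = B"
    using * by (metis assoc_mult_mat left_mult_one_mat)
  finally have "mat_trace A = mat_trace B" .
  also have "mat_trace B = sum_list (diag_mat B)"
    by (simp add: mat_trace_def diag_mat_def interv_sum_list_conv_sum_set_nat lessThan_atLeast0)
  finally show ?thesis unfolding dB .
qed

lemma order_linear_prod_list: "order x (\<Prod>a\<leftarrow>as. [:- a, 1:]) = count_list as (x :: complex)"
proof (induction as)
  case (Cons a as)
  have "order x [:- a, 1:] = (if a = x then 1 else 0)"
    using order_power_n_n[of a 1] by (auto intro: order_0I)
  moreover have "[:- a, 1:] * (\<Prod>a\<leftarrow>as. [:- a, 1:]) \<noteq> 0"
    by (simp only: mult_eq_0_iff prod_list_zero_iff) auto
  ultimately show ?case
    using Cons order_mult[of "[:- a, 1:]" "\<Prod>a\<leftarrow>as. [:- a, 1:]" x] by (simp del: mult_pCons_left)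
qed (simp add: order_0I)

text \<open>Passes from distinct roots weighted by their order, as in \<open>trace_norm\<close>, to
  a list of roots with repetitions, the form in which a factorized characteristic polynomial
  supplies them.\<close>

lemma sum_order_eq_sum_list:
  fixes as :: "complex list" and f :: "complex \<Rightarrow> real"
  defines "p \<equiv> \<Prod>a\<leftarrow>as. [:- a, 1:]"
  shows "(\<Sum>x | poly p x = 0. real (order x p) * f x) = sum_list (map f as)"
proof -
  have "{x. poly p x = 0} = set as"
    unfolding p_def by (induction as) (auto simp: poly_prod_list)
  moreover have "sum_list (map f xs) = (\<Sum>x\<in>set xs. real (count_list xs x) * f x)" for xs
  proof (induction xs)
    case (Cons a xs)
    have "(\<Sum>x\<in>set (a # xs). real (count_list (a # xs) x) * f x)
        = (\<Sum>x\<in>insert a (set xs). real (count_list xs x) * f x + (if x = a then f x else 0))"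
      by (intro sum.cong) (auto simp: algebra_simps)
    also have "\<dots> = (\<Sum>x\<in>insert a (set xs). real (count_list xs x) * f x) + f a"
      by (simp add: sum.distrib)
    also have "(\<Sum>x\<in>insert a (set xs). real (count_list xs x) * f x) = (\<Sum>x\<in>set xs. real (count_list xs x) * f x)"
      by (cases "a \<in> set xs") (auto simp: insert_absorb count_notin)
    finally show ?case using Cons by simp
  qed simp
  ultimately show ?thesis by (simp add: p_def order_linear_prod_list)
qed

lemma index_ketbra [simp]:
  "i < dim_vec v \<Longrightarrow> j < dim_vec v \<Longrightarrow> ketbra v $$ (i, j) = v $ i * cnj (v $ j)"
  "dim_row (ketbra v) = dim_vec v" "dim_col (ketbra v) = dim_vec v"
  unfolding ketbra_def by auto

lemma ketbra_carrier [simp]: "v \<in> carrier_vec d \<Longrightarrow> ketbra v \<in> carrier_mat d d"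
  by (simp add: ketbra_def)

text \<open>For unit vectors with overlap \<open>c\<close>, the square of the difference of the projections has the
  eigenvalues \<open>1 - |c|\<^sup>2\<close> (on the span of the two vectors) and 0.  Its trace \<open>2 (1 - |c|\<^sup>2)\<close>
  therefore determines the trace norm.\<close>

lemma trace_distance_ketbra:
  assumes u: "u \<in> carrier_vec d" "u \<bullet>c u = 1" and v: "v \<in> carrier_vec d" "v \<bullet>c v = 1"
  shows "trace_distance (ketbra u) (ketbra v) = sqrt (1 - (cmod (u \<bullet>c v))\<^sup>2)"
proof -
  define c where "c = u \<bullet>c v"
  define s where "s = 1 - (cmod c)\<^sup>2"
  have su: "(\<Sum>i<d. u $ i * cnj (u $ i)) = 1" and sv: "(\<Sum>i<d. v $ i * cnj (v $ i)) = 1"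
    and suv: "(\<Sum>i<d. u $ i * cnj (v $ i)) = c"
    using u v by (auto simp: cscalar_prod_eq_sum c_def)
  have svu: "(\<Sum>i<d. v $ i * cnj (u $ i)) = cnj c"
    unfolding suv[symmetric] by (simp add: cnj_sum mult.commute)
  have sc: "complex_of_real s = 1 - c * cnj c"
    unfolding s_def of_real_diff by (simp only: complex_norm_square of_real_1)
  define A where "A = ketbra u - ketbra v"
  define B where "B = mat_adjoint A * A"
  have A: "A \<in> carrier_mat d d" using v unfolding A_def by (simp add: minus_carrier_mat)
  have B: "B \<in> carrier_mat d d" using A unfolding B_def by auto
  have Aij: "A $$ (i, j) = u $ i * cnj (u $ j) - v $ i * cnj (v $ j)" if "i < d" "j < d" for i j
    using that u v by (simp add: A_def)
  have Bij: "B $$ (i, j) = u $ i * cnj (u $ j) + v $ i * cnj (v $ j)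
      - cnj c * u $ i * cnj (v $ j) - c * v $ i * cnj (u $ j)" if ij: "i < d" "j < d" for i j
  proof -
    have "B $$ (i, j) = (\<Sum>k<d. cnj (A $$ (k, i)) * A $$ (k, j))"
      using A ij unfolding B_def by (simp add: mat_mult_index_sum del: index_mult_mat(1))
    also have "\<dots> = (\<Sum>k<d. u $ i * cnj (u $ j) * (u $ k * cnj (u $ k)) + v $ i * cnj (v $ j) * (v $ k * cnj (v $ k))
        - u $ i * cnj (v $ j) * (v $ k * cnj (u $ k)) - v $ i * cnj (u $ j) * (u $ k * cnj (v $ k)))"
      using ij by (intro sum.cong) (simp_all add: Aij algebra_simps)
    also have "\<dots> = u $ i * cnj (u $ j) + v $ i * cnj (v $ j)
      - u $ i * cnj (v $ j) * cnj c - v $ i * cnj (u $ j) * c"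
      by (simp add: sum.distrib sum_subtractf sum_distrib_left[symmetric] su sv suv svu)
    finally show ?thesis by (simp add: algebra_simps)
  qed
  have trB: "mat_trace B = 2 * complex_of_real s"
  proof -
    have "mat_trace B = (\<Sum>i<d. u $ i * cnj (u $ i) + v $ i * cnj (v $ i)
      - cnj c * (u $ i * cnj (v $ i)) - c * (v $ i * cnj (u $ i)))"
      using B by (auto simp: mat_trace_def Bij intro!: sum.cong)
    also have "\<dots> = 2 - cnj c * c - c * cnj c"
      by (simp add: sum.distrib sum_subtractf sum_distrib_left[symmetric] su sv suv svu)
    finally show ?thesis unfolding sc by (simp add: algebra_simps)
  qed
  \<comment> \<open>The range of \<open>B\<close> lies in the span of \<open>u\<close> and
    \<open>v\<close>, and \<open>B\<close> acts on both vectors as the scalar \<open>s\<close>.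
    Applying \<open>B\<close> once more to B x = \<kappa> x therefore gives \<kappa>^2 x = s
    \<kappa> x. Parallel \<open>u\<close> and \<open>v\<close> are covered, with \<open>s\<close>
    equal to 0.\<close>
  have ev: "\<kappa> = 0 \<or> \<kappa> = complex_of_real s" if "eigenvalue B \<kappa>" for \<kappa>
  proof -
    from that obtain x where x: "x \<in> carrier_vec d" "x \<noteq> 0\<^sub>v d" "B *\<^sub>v x = \<kappa> \<cdot>\<^sub>v x"
      using B unfolding eigenvalue_def eigenvector_def by auto
    define p where "p = (\<Sum>j<d. cnj (u $ j) * x $ j) - cnj c * (\<Sum>j<d. cnj (v $ j) * x $ j)"
    define q where "q = (\<Sum>j<d. cnj (v $ j) * x $ j) - c * (\<Sum>j<d. cnj (u $ j) * x $ j)"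
    have Bx: "(\<Sum>j<d. B $$ (i, j) * x $ j) = \<kappa> * x $ i" if i: "i < d" for i
    proof -
      have "(B *\<^sub>v x) $ i = (\<kappa> \<cdot>\<^sub>v x) $ i" using x(3) by simp
      then show ?thesis
        using B i x(1) by (simp add: mat_vec_index_sum del: index_mult_mat_vec)
    qed
    have x_uv: "\<kappa> * x $ i = u $ i * p + v $ i * q" if i: "i < d" for i
    proof -
      have "\<kappa> * x $ i = (\<Sum>j<d. u $ i * (cnj (u $ j) * x $ j) + v $ i * (cnj (v $ j) * x $ j)
          - cnj c * u $ i * (cnj (v $ j) * x $ j) - c * v $ i * (cnj (u $ j) * x $ j))"
        unfolding Bx[OF i, symmetric] using i by (intro sum.cong) (simp_all add: Bij algebra_simps)
      then show ?thesis
        by (simp add: sum.distrib sum_subtractf sum_distrib_left[symmetric] p_def q_def algebra_simps)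
    qed
    have Bu: "(\<Sum>j<d. B $$ (i, j) * u $ j) = s * u $ i" if i: "i < d" for i
    proof -
      have "(\<Sum>j<d. B $$ (i, j) * u $ j) = (\<Sum>j<d. u $ i * (u $ j * cnj (u $ j)) + v $ i * (u $ j * cnj (v $ j))
          - cnj c * u $ i * (u $ j * cnj (v $ j)) - c * v $ i * (u $ j * cnj (u $ j)))"
        using i by (intro sum.cong) (simp_all add: Bij algebra_simps)
      also have "\<dots> = u $ i + v $ i * c - cnj c * u $ i * c - c * v $ i"
        by (simp add: sum.distrib sum_subtractf sum_distrib_left[symmetric] su sv suv svu)
      finally show ?thesis by (simp add: sc algebra_simps)
    qed
    have Bv: "(\<Sum>j<d. B $$ (i, j) * v $ j) = s * v $ i" if i: "i < d" for i
    proof -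
      have "(\<Sum>j<d. B $$ (i, j) * v $ j) = (\<Sum>j<d. u $ i * (v $ j * cnj (u $ j)) + v $ i * (v $ j * cnj (v $ j))
          - cnj c * u $ i * (v $ j * cnj (v $ j)) - c * v $ i * (v $ j * cnj (u $ j)))"
        using i by (intro sum.cong) (simp_all add: Bij algebra_simps)
      also have "\<dots> = u $ i * cnj c + v $ i - cnj c * u $ i - c * v $ i * cnj c"
        by (simp add: sum.distrib sum_subtractf sum_distrib_left[symmetric] su sv suv svu)
      finally show ?thesis by (simp add: sc algebra_simps)
    qed
    have "\<kappa> * (\<kappa> * x $ i) = s * (\<kappa> * x $ i)" if i: "i < d" for i
    proof -
      have "\<kappa> * (\<kappa> * x $ i) = (\<Sum>j<d. B $$ (i, j) * (\<kappa> * x $ j))"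
        by (simp only: Bx[OF i, symmetric]) (simp add: sum_distrib_left mult_ac)
      also have "\<dots> = (\<Sum>j<d. B $$ (i, j) * u $ j * p + B $$ (i, j) * v $ j * q)"
        by (intro sum.cong) (simp_all add: x_uv algebra_simps)
      also have "\<dots> = s * u $ i * p + s * v $ i * q"
        using i by (simp add: sum.distrib sum_distrib_right[symmetric] Bu Bv)
      finally show ?thesis using i by (simp add: x_uv algebra_simps)
    qed
    moreover obtain i where "i < d" "x $ i \<noteq> 0" using x(1,2) by (metis carrier_vecD eq_vecI index_zero_vec)
    ultimately show ?thesis by (metis mult_cancel_right mult_eq_0_iff)
  qed
  from char_poly_factorized[OF B] obtain as where cp: "char_poly B = (\<Prod>a\<leftarrow>as. [:- a, 1:])" by auto
  have as: "a = 0 \<or> a = complex_of_real s" if "a \<in> set as" for a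
  proof (rule ev)
    show "eigenvalue B a" unfolding eigenvalue_root_char_poly[OF B] cp
      using that by (induction as) (auto simp: poly_prod_list)
  qed
  have tn: "trace_norm A = sum_list (map (\<lambda>a. sqrt (Re a)) as)"
    unfolding trace_norm_def Let_def B_def[symmetric] cp by (rule sum_order_eq_sum_list)
  have sum_as: "sum_list as = 2 * complex_of_real s"
    using mat_trace_eq_sum_roots[OF B cp] trB by simp
  have Re_as: "sum_list (map Re as) = 2 * s"
  proof -
    have "sum_list (map Re xs) = Re (sum_list xs)" for xs by (induction xs) auto
    then show ?thesis by (simp add: sum_as)
  qed
  \<comment> \<open>This is Cauchy-Schwarz for the two unit vectors, obtained from the positive
    diagonal of \<open>mat_adjoint A * A\<close>.\<close>
  have s0: "0 \<le> s"
  proof -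
    have "0 \<le> Re (B $$ (i, i))" if i: "i < d" for i
    proof -
      have "B $$ (i, i) = (\<Sum>k<d. cnj (A $$ (k, i)) * A $$ (k, i))"
        using A i unfolding B_def by (simp add: mat_mult_index_sum del: index_mult_mat(1))
      also have "Re \<dots> \<ge> 0" unfolding Re_sum by (rule sum_nonneg) simp
      finally show ?thesis .
    qed
    then have "0 \<le> Re (mat_trace B)" using B by (auto simp: mat_trace_def intro!: sum_nonneg)
    then show ?thesis by (simp add: trB)
  qed
  \<comment> \<open>Each root is 0 or \<open>s\<close>, so the product of its square root with
    \<open>sqrt s\<close> is the root itself. The sum of the square roots thus follows from the
    trace, without counting multiplicities.\<close>
  have "sum_list (map (\<lambda>a. sqrt (Re a)) as) * sqrt s = sum_list (map Re as)"
  proof -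
    have "sqrt (Re a) * sqrt s = Re a" if "a \<in> set as" for a
      using as[OF that] s0 by auto
    then show ?thesis by (induction as) (simp_all add: distrib_right)
  qed
  then have "trace_norm A * sqrt s = 2 * sqrt s * sqrt s" using s0 by (simp add: tn Re_as)
  \<comment> \<open>Cancelling \<open>sqrt s\<close> is impossible for \<open>s = 0\<close>; all
    roots then vanish.\<close>
  moreover have "trace_norm A = 0" if "s = 0"
  proof -
    have "sqrt (Re a) = 0" if "a \<in> set as" for a
      using as[OF that] \<open>s = 0\<close> by auto
    then show ?thesis unfolding tn by (induction as) simp_all
  qed
  ultimately have "trace_norm A = 2 * sqrt s" by (cases "s = 0") auto
  then show ?thesis
    by (simp add: trace_distance_def A_def s_def c_def)
qed

section \<open>Kronecker products\<close>

lemma index_kron [simp]: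
  "i < dim_row A * dim_row B \<Longrightarrow> j < dim_col A * dim_col B \<Longrightarrow> (A \<otimes>\<^sub>k B) $$ (i, j)
    = A $$ (i div dim_row B, j div dim_col B) * B $$ (i mod dim_row B, j mod dim_col B)"
  "dim_row (A \<otimes>\<^sub>k B) = dim_row A * dim_row B" "dim_col (A \<otimes>\<^sub>k B) = dim_col A * dim_col B"
  unfolding kron_def by auto

lemma div_mod_less_mult:
  fixes i a b :: nat
  assumes "i < a * b"
  shows "i div b < a" "i mod b < b"
  using assms by (metis less_mult_imp_div_less, metis mod_less_divisor mult_0_right neq0_conv not_less_zero)

lemma kron_carrier [simp]:
  "A \<in> carrier_mat r c \<Longrightarrow> B \<in> carrier_mat r' c' \<Longrightarrow> A \<otimes>\<^sub>k B \<in> carrier_mat (r * r') (c * c')"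
  by (auto simp: kron_def)

lemma mod_mult_div_mod:
  fixes i b c :: nat
  shows "i div (b * c) = i div c div b" "i mod (b * c) div c = i div c mod b" "i mod (b * c) mod c = i mod c"
  by (cases "c = 0"; simp add: div_mult2_eq mod_mult2_eq mult.commute[of b c])+

lemma kron_assoc: "(A \<otimes>\<^sub>k B) \<otimes>\<^sub>k C = A \<otimes>\<^sub>k B \<otimes>\<^sub>k C"
proof (rule eq_matI)
  fix i j assume "i < dim_row (A \<otimes>\<^sub>k B \<otimes>\<^sub>k C)" "j < dim_col (A \<otimes>\<^sub>k B \<otimes>\<^sub>k C)"
  then have i: "i < dim_row A * (dim_row B * dim_row C)" and j: "j < dim_col A * (dim_col B * dim_col C)"
    by auto
  have "i div dim_row C < dim_row A * dim_row B" "j div dim_col C < dim_col A * dim_col B"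
    using div_mod_less_mult(1)[of i "dim_row A * dim_row B"] div_mod_less_mult(1)[of j "dim_col A * dim_col B"] i j
    by (simp_all add: mult.assoc)
  with i j show "((A \<otimes>\<^sub>k B) \<otimes>\<^sub>k C) $$ (i, j) = (A \<otimes>\<^sub>k B \<otimes>\<^sub>k C) $$ (i, j)"
    using div_mod_less_mult(2)[OF i] div_mod_less_mult(2)[OF j]
    by (simp add: mod_mult_div_mod mult.assoc)
qed (auto simp: mult.assoc)

text \<open>An index of a tensor product encodes the pair of indices of its factors as quotient and
  remainder. Matrix products and inner products of Kronecker products factor through this
  splitting.\<close>

lemma sum_div_mod:
  fixes f :: "nat \<Rightarrow> nat \<Rightarrow> 'a :: comm_monoid_add"
  shows "(\<Sum>k<a * b. f (k div b) (k mod b)) = (\<Sum>i<a. \<Sum>j<b. f i j)"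
proof -
  have "(\<Sum>i<a. \<Sum>j<b. f i j) = (\<Sum>(i, j)\<in>{..<a} \<times> {..<b}. f i j)"
    by (rule sum.cartesian_product)
  also have "\<dots> = (\<Sum>k<a * b. f (k div b) (k mod b))"
  proof (rule sum.reindex_bij_witness[of _ "\<lambda>k. (k div b, k mod b)" "\<lambda>(i, j). i * b + j"])
    fix p assume "p \<in> {..<a} \<times> {..<b}"
    then obtain i j where p: "p = (i, j)" "i < a" "j < b" by auto
    have "i * b + j < Suc i * b" using p by simp
    also have "\<dots> \<le> a * b" using p by (intro mult_right_mono) auto
    finally show "(case p of (i, j) \<Rightarrow> i * b + j) \<in> {..<a * b}" using p by simp
  qed (auto simp: div_mod_less_mult)
  finally show ?thesis ..
qed

lemma kron_mult:
  assumes "A \<in> carrier_mat r m" "B \<in> carrier_mat r' m'" "C \<in> carrier_mat m c" "D \<in> carrier_mat m' c'"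
  shows "(A \<otimes>\<^sub>k B) * (C \<otimes>\<^sub>k D) = (A * C) \<otimes>\<^sub>k (B * D)"
proof (rule eq_matI)
  fix i j assume "i < dim_row ((A * C) \<otimes>\<^sub>k (B * D))" "j < dim_col ((A * C) \<otimes>\<^sub>k (B * D))"
  then have ij: "i < r * r'" "j < c * c'" using assms by auto
  have "((A \<otimes>\<^sub>k B) * (C \<otimes>\<^sub>k D)) $$ (i, j) = (\<Sum>k<m * m'.
      A $$ (i div r', k div m') * B $$ (i mod r', k mod m') * (C $$ (k div m', j div c') * D $$ (k mod m', j mod c')))"
    using assms ij by (subst mat_mult_index_sum) (auto intro!: sum.cong)
  also have "\<dots> = (\<Sum>k<m. \<Sum>l<m'. A $$ (i div r', k) * B $$ (i mod r', l) * (C $$ (k, j div c') * D $$ (l, j mod c')))"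
    by (rule sum_div_mod)
  also have "\<dots> = (\<Sum>k<m. A $$ (i div r', k) * C $$ (k, j div c')) * (\<Sum>l<m'. B $$ (i mod r', l) * D $$ (l, j mod c'))"
    by (simp add: sum_product mult_ac)
  also have "\<dots> = ((A * C) \<otimes>\<^sub>k (B * D)) $$ (i, j)"
    using assms ij by (simp add: div_mod_less_mult mat_mult_index_sum del: index_mult_mat(1))
  finally show "((A \<otimes>\<^sub>k B) * (C \<otimes>\<^sub>k D)) $$ (i, j) = ((A * C) \<otimes>\<^sub>k (B * D)) $$ (i, j)" .
qed (use assms in auto)

lemma kron_one: "1\<^sub>m a \<otimes>\<^sub>k 1\<^sub>m b = 1\<^sub>m (a * b)"
proof (rule eq_matI)
  fix i j assume "i < dim_row (1\<^sub>m (a * b) :: complex mat)" "j < dim_col (1\<^sub>m (a * b) :: complex mat)"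
  then have ij: "i < a * b" "j < a * b" by auto
  have "i = j \<longleftrightarrow> i div b = j div b \<and> i mod b = j mod b" by (metis div_mult_mod_eq)
  with ij show "(1\<^sub>m a \<otimes>\<^sub>k 1\<^sub>m b) $$ (i, j) = (1\<^sub>m (a * b) :: complex mat) $$ (i, j)"
    by (simp add: div_mod_less_mult)
qed auto

lemma mat_adjoint_kron: "mat_adjoint (A \<otimes>\<^sub>k B) = mat_adjoint A \<otimes>\<^sub>k mat_adjoint B"
  by (rule eq_matI) (auto simp: div_mod_less_mult)

section \<open>Operators acting on one qubit\<close>

lemma on_qubit_split: "k < n \<Longrightarrow> (2::nat) ^ n = 2 ^ k * (2 * 2 ^ (n - Suc k))"
  by (metis Suc_diff_Suc add_diff_inverse_nat less_imp_not_less power_Suc power_add)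

lemma on_qubit_carrier [simp]:
  "k < n \<Longrightarrow> P \<in> carrier_mat 2 2 \<Longrightarrow> on_qubit n k P \<in> carrier_mat (2 ^ n) (2 ^ n)"
  unfolding on_qubit_def by (auto simp: on_qubit_split[of k n])

lemma on_qubit_mult:
  assumes "k < n" and P: "P \<in> carrier_mat 2 2" and R: "R \<in> carrier_mat 2 2"
  shows "on_qubit n k P * on_qubit n k R = on_qubit n k (P * R)"
proof -
  define m :: nat where "m = 2 ^ (n - k - 1)"
  have "(1\<^sub>m (2 ^ k) \<otimes>\<^sub>k P \<otimes>\<^sub>k 1\<^sub>m m) * (1\<^sub>m (2 ^ k) \<otimes>\<^sub>k R \<otimes>\<^sub>k 1\<^sub>m m)
      = (1\<^sub>m (2 ^ k) * 1\<^sub>m (2 ^ k)) \<otimes>\<^sub>k ((P \<otimes>\<^sub>k 1\<^sub>m m) * (R \<otimes>\<^sub>k 1\<^sub>m m))"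
    using P R by (intro kron_mult) auto
  also have "(P \<otimes>\<^sub>k 1\<^sub>m m) * (R \<otimes>\<^sub>k 1\<^sub>m m) = (P * R) \<otimes>\<^sub>k (1\<^sub>m m * 1\<^sub>m m)"
    using P R by (intro kron_mult) auto
  finally show ?thesis by (simp add: on_qubit_def m_def)
qed

lemma on_qubit_one: "k < n \<Longrightarrow> on_qubit n k (1\<^sub>m 2) = 1\<^sub>m (2 ^ n)"
  unfolding on_qubit_def by (simp add: kron_one on_qubit_split)

lemma mat_adjoint_on_qubit: "mat_adjoint (on_qubit n k P) = on_qubit n k (mat_adjoint P)"
  unfolding on_qubit_def by (simp add: mat_adjoint_kron)

lemma on_qubit_smult: "on_qubit n k (c \<cdot>\<^sub>m P) = c \<cdot>\<^sub>m on_qubit n k P" if "P \<in> carrier_mat 2 2"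
  using that unfolding on_qubit_def by (intro eq_matI) (auto simp: div_mod_less_mult)

lemma on_qubit_commute_less:
  assumes kj: "k < j" "j < n" and P: "P \<in> carrier_mat 2 2" and R: "R \<in> carrier_mat 2 2"
  shows "on_qubit n k P * on_qubit n j R = on_qubit n j R * on_qubit n k P"
proof -
  define m :: nat where "m = 2 ^ (n - k - 1)"
  define S where "S = 1\<^sub>m (2 ^ (j - k - 1)) \<otimes>\<^sub>k R \<otimes>\<^sub>k 1\<^sub>m (2 ^ (n - j - 1))"
  have "(2::nat) ^ (n - k - 1) = 2 ^ (j - k - 1) * (2 * 2 ^ (n - j - 1))"
    using on_qubit_split[of "j - k - 1" "n - k - 1"] kj by simp
  then have S: "S \<in> carrier_mat m m" using R by (auto simp: S_def m_def)
  have "(2::nat) ^ j = 2 ^ k * (2 * 2 ^ (j - k - 1))" using on_qubit_split[of k j] kj by simp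
  \<comment> \<open>The identity in front of qubit \<open>j\<close> is cut at qubit
    \<open>k\<close>, and its part behind qubit \<open>k\<close> is absorbed into \<open>S\<close>.
    Both operators then have the same three tensor factors, and in each factor one of the two is the
    identity.\<close>
  then have j: "on_qubit n j R = 1\<^sub>m (2 ^ k) \<otimes>\<^sub>k 1\<^sub>m 2 \<otimes>\<^sub>k S"
    by (simp add: on_qubit_def S_def kron_one[symmetric] kron_assoc)
  have k: "on_qubit n k P = 1\<^sub>m (2 ^ k) \<otimes>\<^sub>k P \<otimes>\<^sub>k 1\<^sub>m m"
    by (simp add: on_qubit_def m_def)
  have *: "(1\<^sub>m (2 ^ k) \<otimes>\<^sub>k P' \<otimes>\<^sub>k S') * (1\<^sub>m (2 ^ k) \<otimes>\<^sub>k R' \<otimes>\<^sub>k T')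
      = 1\<^sub>m (2 ^ k) \<otimes>\<^sub>k (P' * R') \<otimes>\<^sub>k (S' * T')"
    if "P' \<in> carrier_mat 2 2" "R' \<in> carrier_mat 2 2" "S' \<in> carrier_mat m m" "T' \<in> carrier_mat m m" for P' R' S' T'
  proof -
    have "(1\<^sub>m (2 ^ k) \<otimes>\<^sub>k P' \<otimes>\<^sub>k S') * (1\<^sub>m (2 ^ k) \<otimes>\<^sub>k R' \<otimes>\<^sub>k T')
        = (1\<^sub>m (2 ^ k) * 1\<^sub>m (2 ^ k)) \<otimes>\<^sub>k ((P' \<otimes>\<^sub>k S') * (R' \<otimes>\<^sub>k T'))"
      using that by (intro kron_mult) auto
    also have "(P' \<otimes>\<^sub>k S') * (R' \<otimes>\<^sub>k T') = (P' * R') \<otimes>\<^sub>k (S' * T')"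
      using that by (intro kron_mult) auto
    finally show ?thesis by simp
  qed
  show ?thesis unfolding j k using P S by (simp add: *)
qed

lemma on_qubit_commute:
  assumes "k \<noteq> j" "k < n" "j < n" "P \<in> carrier_mat 2 2" "R \<in> carrier_mat 2 2"
  shows "on_qubit n k P * on_qubit n j R = on_qubit n j R * on_qubit n k P"
proof (cases "k < j")
  case False
  then show ?thesis using assms by (intro on_qubit_commute_less[symmetric]) auto
qed (use assms on_qubit_commute_less in auto)

section \<open>The Clifford relations of the Majorana operators\<close>

text \<open>Keeping the scalar explicit lets it multiply along products, so that the sign of a pair
  of Majorana operators is found factor by factor.\<close>

definition commute_up_to :: "complex \<Rightarrow> complex mat \<Rightarrow> complex mat \<Rightarrow> bool" where
  "commute_up_to c A B \<longleftrightarrow> A * B = c \<cdot>\<^sub>m (B * A)"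

lemma one_smult_mat [simp]: "1 \<cdot>\<^sub>m (A :: complex mat) = A"
  by (rule eq_matI) auto

lemma smult_smult_mat: "a \<cdot>\<^sub>m (b \<cdot>\<^sub>m A) = (a * b) \<cdot>\<^sub>m (A :: complex mat)"
  by (rule eq_matI) auto

lemma commute_up_to_mult_left:
  assumes c: "A \<in> carrier_mat d d" "B \<in> carrier_mat d d" "X \<in> carrier_mat d d"
    and "commute_up_to a A X" "commute_up_to b B X"
  shows "commute_up_to (a * b) (A * B) X"
proof -
  note assoc_mult_mat[of _ d d _ d _ d, simp] mult_smult_distrib[of _ d d _ d, simp] mult_smult_assoc_mat[of _ d d _ d, simp]
  have "A * B * X = A * (b \<cdot>\<^sub>m (X * B))" using assms by (simp add: commute_up_to_def)
  also have "\<dots> = b \<cdot>\<^sub>m ((A * X) * B)" using c by simp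
  also have "\<dots> = b \<cdot>\<^sub>m ((a \<cdot>\<^sub>m (X * A)) * B)" using assms by (simp only: commute_up_to_def)
  also have "\<dots> = (a * b) \<cdot>\<^sub>m (X * (A * B))" using c by (simp add: smult_smult_mat mult.commute)
  finally show ?thesis by (simp add: commute_up_to_def)
qed

lemma commute_up_to_sym:
  "commute_up_to c A B \<Longrightarrow> c * c = 1 \<Longrightarrow> commute_up_to c B A"
  by (simp add: commute_up_to_def smult_smult_mat)

lemma commute_up_to_mult_right:
  assumes c: "A \<in> carrier_mat d d" "B \<in> carrier_mat d d" "X \<in> carrier_mat d d"
    and "commute_up_to a X A" "commute_up_to b X B"
  shows "commute_up_to (a * b) X (A * B)"
proof -
  note assoc_mult_mat[of _ d d _ d _ d, simp] mult_smult_distrib[of _ d d _ d, simp] mult_smult_assoc_mat[of _ d d _ d, simp]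
  have "X * (A * B) = (X * A) * B" using c by simp
  also have "\<dots> = (a \<cdot>\<^sub>m (A * X)) * B" using assms by (simp only: commute_up_to_def)
  also have "\<dots> = a \<cdot>\<^sub>m (A * (X * B))" using c by simp
  also have "\<dots> = a \<cdot>\<^sub>m (A * (b \<cdot>\<^sub>m (B * X)))" using assms by (simp only: commute_up_to_def)
  also have "\<dots> = (a * b) \<cdot>\<^sub>m (A * B * X)" using c by (simp add: smult_smult_mat)
  finally show ?thesis by (simp add: commute_up_to_def)
qed

lemma pauli_carrier [simp]:
  "pauli_X \<in> carrier_mat 2 2" "pauli_Y \<in> carrier_mat 2 2" "pauli_Z \<in> carrier_mat 2 2"
  by (auto simp: pauli_X_def pauli_Y_def pauli_Z_def mat_of_rows_list_def)

lemma pauli_index [simp]: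
  "pauli_X $$ (0, 0) = 0" "pauli_X $$ (0, Suc 0) = 1" "pauli_X $$ (Suc 0, 0) = 1" "pauli_X $$ (Suc 0, Suc 0) = 0"
  "pauli_Y $$ (0, 0) = 0" "pauli_Y $$ (0, Suc 0) = - \<i>" "pauli_Y $$ (Suc 0, 0) = \<i>" "pauli_Y $$ (Suc 0, Suc 0) = 0"
  "pauli_Z $$ (0, 0) = 1" "pauli_Z $$ (0, Suc 0) = 0" "pauli_Z $$ (Suc 0, 0) = 0" "pauli_Z $$ (Suc 0, Suc 0) = - 1"
  by (simp_all add: pauli_X_def pauli_Y_def pauli_Z_def mat_of_rows_list_def)

lemma pauli_dim [simp]:
  "dim_row pauli_X = 2" "dim_col pauli_X = 2" "dim_row pauli_Y = 2" "dim_col pauli_Y = 2"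
  "dim_row pauli_Z = 2" "dim_col pauli_Z = 2"
  using pauli_carrier unfolding carrier_mat_def by simp_all

lemma eq_mat_2I:
  assumes "A \<in> carrier_mat 2 2" "B \<in> carrier_mat 2 2"
    "A $$ (0, 0) = B $$ (0, 0)" "A $$ (0, Suc 0) = B $$ (0, Suc 0)"
    "A $$ (Suc 0, 0) = B $$ (Suc 0, 0)" "A $$ (Suc 0, Suc 0) = B $$ (Suc 0, Suc 0)"
  shows "A = B"
  using assms by (intro eq_matI) (auto simp: less_2_cases_iff)

lemma mult_mat_2_index:
  assumes "A \<in> carrier_mat 2 2" "B \<in> carrier_mat 2 2" "i < 2" "j < 2"
  shows "(A * B) $$ (i, j) = A $$ (i, 0) * B $$ (0, j) + A $$ (i, Suc 0) * B $$ (Suc 0, j)"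
  using assms by (subst mat_mult_index_sum) (auto simp: numeral_2_eq_2)

lemma pauli_algebra:
  "pauli_X * pauli_X = 1\<^sub>m 2" "pauli_Y * pauli_Y = 1\<^sub>m 2" "pauli_Z * pauli_Z = 1\<^sub>m 2"
  "pauli_X * pauli_Y = \<i> \<cdot>\<^sub>m pauli_Z" "pauli_Y * pauli_X = - \<i> \<cdot>\<^sub>m pauli_Z"
  "mat_adjoint pauli_X = pauli_X" "mat_adjoint pauli_Y = pauli_Y" "mat_adjoint pauli_Z = pauli_Z"
  "commute_up_to (- 1) pauli_Z pauli_X" "commute_up_to (- 1) pauli_Z pauli_Y"
  "commute_up_to (- 1) pauli_X pauli_Y" "commute_up_to 1 pauli_Z pauli_Z"
  unfolding commute_up_to_def
  by (rule eq_mat_2I; simp add: mult_mat_2_index mult_carrier_mat[of _ 2 2] del: index_mult_mat(1))+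

lemma commute_up_to_on_qubit:
  assumes "k < n" "P \<in> carrier_mat 2 2" "R \<in> carrier_mat 2 2" "commute_up_to c P R"
  shows "commute_up_to c (on_qubit n k P) (on_qubit n k R)"
  using assms by (simp add: commute_up_to_def on_qubit_mult on_qubit_smult)

section \<open>Strings of Z operators\<close>

lemma Z_string_0: "Z_string n 0 = 1\<^sub>m (2 ^ n)"
  by (simp add: Z_string_def)

lemma foldr_mult_mat:
  assumes "set Ms \<subseteq> carrier_mat d d" "A \<in> carrier_mat d d"
  shows "foldr (*) Ms A \<in> carrier_mat d d"
    and "foldr (*) Ms A = foldr (*) Ms (1\<^sub>m d) * (A :: complex mat)"
proof -
  have *: "foldr (*) Ms A \<in> carrier_mat d d"
    if "set Ms \<subseteq> carrier_mat d d" "A \<in> carrier_mat d d" for Ms and A :: "complex mat"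
    using that by (induction Ms) auto
  from assms show "foldr (*) Ms A \<in> carrier_mat d d" by (rule *)
  show "foldr (*) Ms A = foldr (*) Ms (1\<^sub>m d) * A"
    using assms
  proof (induction Ms)
    case (Cons M Ms)
    then show ?case using *[of Ms "1\<^sub>m d"] by (simp add: assoc_mult_mat[of _ d d _ d _ d])
  qed simp
qed

lemma Z_string_carrier [simp]: "k \<le> n \<Longrightarrow> Z_string n k \<in> carrier_mat (2 ^ n) (2 ^ n)"
  unfolding Z_string_def by (rule foldr_mult_mat(1)) auto

lemma Z_string_Suc: "k < n \<Longrightarrow> Z_string n (Suc k) = Z_string n k * on_qubit n k pauli_Z"
  unfolding Z_string_def
  by (simp add: right_mult_one_mat[of _ "2 ^ n"],
    rule foldr_mult_mat(2)[where d = "2 ^ n"]) auto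

text \<open>The string meets qubit \<open>j\<close> at most once, and only that factor can
  contribute \<open>c\<close>; all others act on different qubits and commute with
  \<open>P\<close>.\<close>

lemma Z_string_on_qubit:
  assumes j: "j < n" and P: "P \<in> carrier_mat 2 2" and c: "commute_up_to c pauli_Z P" and "k \<le> n"
  shows "commute_up_to (if j < k then c else 1) (Z_string n k) (on_qubit n j P)"
  using \<open>k \<le> n\<close>
proof (induction k)
  case 0
  then show ?case using on_qubit_carrier[OF j P] by (simp add: Z_string_0 commute_up_to_def)
next
  case (Suc k)
  have "commute_up_to (if j = k then c else 1) (on_qubit n k pauli_Z) (on_qubit n j P)"
    using Suc j P c commute_up_to_on_qubit[OF j _ P c] on_qubit_commute[of k j n pauli_Z P]
    by (auto simp: commute_up_to_def)
  then have "commute_up_to ((if j < k then c else 1) * (if j = k then c else 1))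
      (Z_string n k * on_qubit n k pauli_Z) (on_qubit n j P)"
    using Suc j P by (intro commute_up_to_mult_left[where d = "2 ^ n"]) auto
  then show ?case using Suc.prems by (auto simp: Z_string_Suc less_Suc_eq split: if_splits)
qed

lemma Z_string_commute:
  assumes "k \<le> n" "j \<le> n"
  shows "commute_up_to 1 (Z_string n k) (Z_string n j)"
  using \<open>j \<le> n\<close>
proof (induction j)
  case 0
  then show ?case using Z_string_carrier[OF \<open>k \<le> n\<close>] by (simp add: Z_string_0 commute_up_to_def)
next
  case (Suc j)
  have "commute_up_to 1 (Z_string n k) (on_qubit n j pauli_Z)"
    using Z_string_on_qubit[of j n pauli_Z 1 k] Suc.prems \<open>k \<le> n\<close> pauli_algebra(12) by simp
  then have "commute_up_to (1 * 1) (Z_string n k) (Z_string n j * on_qubit n j pauli_Z)"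
    using Suc \<open>k \<le> n\<close> by (intro commute_up_to_mult_right[where d = "2 ^ n"]) auto
  then show ?case using Suc.prems by (simp add: Z_string_Suc)
qed

text \<open>Serves to cancel a common Z string from a product of two operators.\<close>

lemma mult_commuting_involutions:
  assumes "A \<in> carrier_mat d d" "B \<in> carrier_mat d d" "C \<in> carrier_mat d d" "commute_up_to 1 A B" "A * A = 1\<^sub>m d"
  shows "(A * B) * (A * C) = B * C"
proof -
  note assoc_mult_mat[of _ d d _ d _ d, simp]
  have "(A * B) * (A * C) = (A * B) * A * C" using assms by simp
  also have "\<dots> = (B * A) * A * C" using assms(4) by (simp add: commute_up_to_def)
  also have "\<dots> = B * ((A * A) * C)" using assms(1-3) by simp
  also have "\<dots> = B * C" using assms by simp
  finally show ?thesis .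
qed

lemma Z_string_square: "k \<le> n \<Longrightarrow> Z_string n k * Z_string n k = 1\<^sub>m (2 ^ n)"
proof (induction k)
  case (Suc k)
  then have "commute_up_to 1 (Z_string n k) (on_qubit n k pauli_Z)"
    using Z_string_on_qubit[of k n pauli_Z 1 k] pauli_algebra(12) by simp
  with Suc show ?case
    by (simp add: Z_string_Suc mult_commuting_involutions[where d = "2 ^ n"] on_qubit_mult pauli_algebra on_qubit_one)
qed (simp add: Z_string_0)

lemma Z_string_adjoint: "k \<le> n \<Longrightarrow> mat_adjoint (Z_string n k) = Z_string n k"
proof (induction k)
  case (Suc k)
  then have "commute_up_to 1 (Z_string n k) (on_qubit n k pauli_Z)"
    using Z_string_on_qubit[of k n pauli_Z 1 k] pauli_algebra(12) by simp
  with Suc show ?case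
    by (simp add: Z_string_Suc mat_adjoint_mult[of _ "2 ^ n" "2 ^ n" _ "2 ^ n"] mat_adjoint_on_qubit pauli_algebra commute_up_to_def)
qed (simp add: Z_string_0)

section \<open>Hermiticity and anticommutation of the Majorana operators\<close>

definition pauli_XY :: "nat \<Rightarrow> complex mat" where
  "pauli_XY \<mu> = (if even \<mu> then pauli_X else pauli_Y)"

text \<open>These common properties of X and Y suffice except for two different Majorana operators
  on the same qubit, where X and Y have to be told apart.\<close>

lemma pauli_XY [simp]:
  "pauli_XY \<mu> \<in> carrier_mat 2 2" "pauli_XY \<mu> * pauli_XY \<mu> = 1\<^sub>m 2" "mat_adjoint (pauli_XY \<mu>) = pauli_XY \<mu>"
  "commute_up_to (- 1) pauli_Z (pauli_XY \<mu>)"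
  by (auto simp: pauli_XY_def pauli_algebra)

lemma majorana_eq: "majorana n \<mu> = Z_string n (\<mu> div 2) * on_qubit n (\<mu> div 2) (pauli_XY \<mu>)"
  by (simp add: majorana_def pauli_XY_def)

lemma Z_string_pauli_XY:
  assumes "k \<le> n" "j < n"
  shows "commute_up_to (if j < k then - 1 else 1) (Z_string n k) (on_qubit n j (pauli_XY \<mu>))"
  using Z_string_on_qubit[of j n "pauli_XY \<mu>" "- 1" k] assms by auto

lemma majorana_carrier [simp]:
  assumes "\<mu> < 2 * n" shows "majorana n \<mu> \<in> carrier_mat (2 ^ n) (2 ^ n)"
proof -
  have "\<mu> div 2 < n" using assms by auto
  then show ?thesis unfolding majorana_eq by (intro mult_carrier_mat[where n = "2 ^ n"]) auto
qed

lemma majorana_adjoint: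
  assumes "\<mu> < 2 * n" shows "mat_adjoint (majorana n \<mu>) = majorana n \<mu>"
proof -
  define k where "k = \<mu> div 2"
  have k: "k < n" using assms by (auto simp: k_def)
  have "mat_adjoint (majorana n \<mu>) = mat_adjoint (on_qubit n k (pauli_XY \<mu>)) * mat_adjoint (Z_string n k)"
    unfolding majorana_eq k_def[symmetric] using k by (intro mat_adjoint_mult[of _ "2 ^ n" "2 ^ n" _ "2 ^ n"]) auto
  also have "\<dots> = on_qubit n k (pauli_XY \<mu>) * Z_string n k"
    using k by (simp add: Z_string_adjoint mat_adjoint_on_qubit)
  also have "\<dots> = Z_string n k * on_qubit n k (pauli_XY \<mu>)"
    using Z_string_pauli_XY[of k n k \<mu>] k by (simp add: commute_up_to_def)
  finally show ?thesis by (simp add: majorana_eq k_def)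
qed

text \<open>The two operators carry the same Z string, which commutes with the local factor behind
  it and squares to the identity.\<close>

lemma majorana_mult_same_qubit:
  assumes "\<mu> < 2 * n" "\<mu> div 2 = \<nu> div 2"
  shows "majorana n \<mu> * majorana n \<nu> = on_qubit n (\<mu> div 2) (pauli_XY \<mu> * pauli_XY \<nu>)"
proof -
  define k where "k = \<mu> div 2"
  have k: "k < n" using assms by (auto simp: k_def)
  have "commute_up_to 1 (Z_string n k) (on_qubit n k (pauli_XY \<mu>))"
    using Z_string_pauli_XY[of k n k \<mu>] k by simp
  then have "(Z_string n k * on_qubit n k (pauli_XY \<mu>)) * (Z_string n k * on_qubit n k (pauli_XY \<nu>))
      = on_qubit n k (pauli_XY \<mu>) * on_qubit n k (pauli_XY \<nu>)"
    using k by (intro mult_commuting_involutions[where d = "2 ^ n"]) (auto simp: Z_string_square)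
  also have "\<dots> = on_qubit n k (pauli_XY \<mu> * pauli_XY \<nu>)"
    using k by (simp add: on_qubit_mult)
  finally show ?thesis unfolding majorana_eq assms(2)[symmetric] k_def .
qed

lemma majorana_square:
  assumes "\<mu> < 2 * n" shows "majorana n \<mu> * majorana n \<mu> = 1\<^sub>m (2 ^ n)"
proof -
  have "\<mu> div 2 < n" using assms by auto
  with majorana_mult_same_qubit[OF assms, of \<mu>] show ?thesis by (simp add: on_qubit_one)
qed

text \<open>Exactly one sign arises: the longer string contains a Z on the qubit where the other
  operator has its X or Y. Every other pair of factors commutes.\<close>

lemma majorana_anticommute_less:
  assumes "\<nu> < 2 * n" "\<mu> div 2 < \<nu> div 2"
  shows "commute_up_to (- 1) (majorana n \<mu>) (majorana n \<nu>)"
proof -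
  define k j where "k = \<mu> div 2" and "j = \<nu> div 2"
  have kj: "k < j" "j < n" using assms unfolding k_def j_def by linarith+
  have "commute_up_to 1 (Z_string n k) (Z_string n j)"
    using kj by (intro Z_string_commute) auto
  moreover have "commute_up_to 1 (Z_string n k) (on_qubit n j (pauli_XY \<nu>))"
    using Z_string_pauli_XY[of k n j \<nu>] kj by simp
  ultimately have 1: "commute_up_to (1 * 1) (Z_string n k) (Z_string n j * on_qubit n j (pauli_XY \<nu>))"
    using kj by (intro commute_up_to_mult_right[where d = "2 ^ n"]) auto
  have "commute_up_to (- 1) (on_qubit n k (pauli_XY \<mu>)) (Z_string n j)"
    by (rule commute_up_to_sym) (use Z_string_pauli_XY[of j n k \<mu>] kj in auto)
  moreover have "commute_up_to 1 (on_qubit n k (pauli_XY \<mu>)) (on_qubit n j (pauli_XY \<nu>))"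
    using kj by (simp add: commute_up_to_def on_qubit_commute)
  ultimately have 2: "commute_up_to (- 1 * 1) (on_qubit n k (pauli_XY \<mu>)) (Z_string n j * on_qubit n j (pauli_XY \<nu>))"
    using kj by (intro commute_up_to_mult_right[where d = "2 ^ n"]) auto
  have "Z_string n j * on_qubit n j (pauli_XY \<nu>) \<in> carrier_mat (2 ^ n) (2 ^ n)"
    using kj by (intro mult_carrier_mat[where n = "2 ^ n"]) auto
  then have "commute_up_to ((1 * 1) * (- 1 * 1)) (Z_string n k * on_qubit n k (pauli_XY \<mu>)) (Z_string n j * on_qubit n j (pauli_XY \<nu>))"
    using kj by (intro commute_up_to_mult_left[OF _ _ _ 1 2, where d = "2 ^ n"]) auto
  then show ?thesis by (simp add: majorana_eq k_def j_def)
qed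

lemma majorana_anticommute:
  assumes "\<mu> < 2 * n" "\<nu> < 2 * n" "\<mu> \<noteq> \<nu>"
  shows "commute_up_to (- 1) (majorana n \<mu>) (majorana n \<nu>)"
proof (cases "\<mu> div 2" "\<nu> div 2" rule: linorder_cases)
  case equal
  have "even \<mu> \<noteq> even \<nu>" using assms(3) equal by presburger
  then have "pauli_XY \<mu> * pauli_XY \<nu> = - 1 \<cdot>\<^sub>m (pauli_XY \<nu> * pauli_XY \<mu>)"
    by (auto simp: pauli_XY_def pauli_algebra smult_smult_mat)
  then show ?thesis
    using assms equal majorana_mult_same_qubit[OF assms(1) equal] majorana_mult_same_qubit[OF assms(2) equal[symmetric]]
    by (simp add: commute_up_to_def on_qubit_smult mult_carrier_mat[of _ 2 2])
next
  case less
  then show ?thesis using assms majorana_anticommute_less by simp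
next
  case greater
  then show ?thesis using assms majorana_anticommute_less commute_up_to_sym by simp
qed

text \<open>A Majorana operator has exactly one factor X or Y, which anticommutes with the full
  string, while its own Z string commutes with it.\<close>

lemma parity_anticommute:
  assumes "\<mu> < 2 * n"
  shows "commute_up_to (- 1) (Z_string n n) (majorana n \<mu>)"
proof -
  have k: "\<mu> div 2 < n" using assms by auto
  have "commute_up_to (1 * - 1) (Z_string n n) (Z_string n (\<mu> div 2) * on_qubit n (\<mu> div 2) (pauli_XY \<mu>))"
    using Z_string_pauli_XY[of n n "\<mu> div 2" \<mu>] k
    by (intro commute_up_to_mult_right[where d = "2 ^ n"] Z_string_commute) auto
  then show ?thesis by (simp add: majorana_eq)
qed

text \<open>This makes Z on one qubit a quadratic Majorana operator, so that its expectation is an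
  entry of a correlation matrix.\<close>

lemma majorana_pair:
  assumes "k < n"
  shows "majorana n (2 * k) * majorana n (2 * k + 1) = \<i> \<cdot>\<^sub>m on_qubit n k pauli_Z"
  using majorana_mult_same_qubit[of "2 * k" n "2 * k + 1"] assms
  by (simp add: pauli_XY_def pauli_algebra on_qubit_smult)

section \<open>Real linear combinations of Majorana operators\<close>

text \<open>The family \<open>f\<close> is arbitrary because products and conjugates of Majorana
  operators have to be combined too, and combinations are nested.\<close>

definition mat_comb :: "nat \<Rightarrow> nat \<Rightarrow> (nat \<Rightarrow> complex mat) \<Rightarrow> (nat \<Rightarrow> real) \<Rightarrow> complex mat" where
  "mat_comb d m f v = mat d d (\<lambda>(a, b). \<Sum>\<nu><m. complex_of_real (v \<nu>) * f \<nu> $$ (a, b))"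

lemma mat_comb_carrier [simp]: "mat_comb d m f v \<in> carrier_mat d d"
  by (simp add: mat_comb_def)

lemma mat_comb_index [simp]:
  "a < d \<Longrightarrow> b < d \<Longrightarrow> mat_comb d m f v $$ (a, b) = (\<Sum>\<nu><m. complex_of_real (v \<nu>) * f \<nu> $$ (a, b))"
  "dim_row (mat_comb d m f v) = d" "dim_col (mat_comb d m f v) = d"
  by (simp_all add: mat_comb_def)

lemma mat_comb_cong:
  "(\<And>\<nu>. \<nu> < m \<Longrightarrow> f \<nu> = g \<nu>) \<Longrightarrow> (\<And>\<nu>. \<nu> < m \<Longrightarrow> v \<nu> = w \<nu>) \<Longrightarrow> mat_comb d m f v = mat_comb d m g w"
  by (auto simp: mat_comb_def intro!: sum.cong)

lemma mult_mat_comb: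
  assumes "A \<in> carrier_mat d d" "\<And>\<nu>. \<nu> < m \<Longrightarrow> f \<nu> \<in> carrier_mat d d"
  shows "A * mat_comb d m f v = mat_comb d m (\<lambda>\<nu>. A * f \<nu>) v"
proof (rule eq_matI)
  fix a b assume "a < dim_row (mat_comb d m (\<lambda>\<nu>. A * f \<nu>) v)" "b < dim_col (mat_comb d m (\<lambda>\<nu>. A * f \<nu>) v)"
  then have ab: "a < d" "b < d" by auto
  have "(A * mat_comb d m f v) $$ (a, b) = (\<Sum>k<d. \<Sum>\<nu><m. A $$ (a, k) * (complex_of_real (v \<nu>) * f \<nu> $$ (k, b)))"
    using assms ab by (simp add: mat_mult_index_sum sum_distrib_left del: index_mult_mat(1))
  also have "\<dots> = (\<Sum>\<nu><m. \<Sum>k<d. A $$ (a, k) * (complex_of_real (v \<nu>) * f \<nu> $$ (k, b)))" by (rule sum.swap)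
  also have "\<dots> = (\<Sum>\<nu><m. complex_of_real (v \<nu>) * (A * f \<nu>) $$ (a, b))"
  proof (rule sum.cong)
    fix \<nu> assume "\<nu> \<in> {..<m}"
    then have "f \<nu> \<in> carrier_mat d d" using assms(2) by simp
    then show "(\<Sum>k<d. A $$ (a, k) * (complex_of_real (v \<nu>) * f \<nu> $$ (k, b))) = complex_of_real (v \<nu>) * (A * f \<nu>) $$ (a, b)"
      using assms(1) ab by (simp add: mat_mult_index_sum sum_distrib_left mult_ac del: index_mult_mat(1))
  qed simp
  finally show "(A * mat_comb d m f v) $$ (a, b) = mat_comb d m (\<lambda>\<nu>. A * f \<nu>) v $$ (a, b)" using ab by simp
qed (use assms in auto)

lemma mat_adjoint_mat_comb:
  assumes "\<And>\<nu>. \<nu> < m \<Longrightarrow> f \<nu> \<in> carrier_mat d d"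
  shows "mat_adjoint (mat_comb d m f v) = mat_comb d m (\<lambda>\<nu>. mat_adjoint (f \<nu>)) v"
proof (rule eq_matI)
  fix a b assume "a < dim_row (mat_comb d m (\<lambda>\<nu>. mat_adjoint (f \<nu>)) v)" "b < dim_col (mat_comb d m (\<lambda>\<nu>. mat_adjoint (f \<nu>)) v)"
  then have ab: "a < d" "b < d" by auto
  have "cnj (f \<nu> $$ (b, a)) = mat_adjoint (f \<nu>) $$ (a, b)" if "\<nu> < m" for \<nu>
    using assms[OF that] ab by simp
  then show "mat_adjoint (mat_comb d m f v) $$ (a, b) = mat_comb d m (\<lambda>\<nu>. mat_adjoint (f \<nu>)) v $$ (a, b)"
    using ab by (simp add: cnj_sum)
qed auto

text \<open>Reduced to multiplication from the left by taking adjoints, which leave the real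
  coefficients unchanged.\<close>

lemma mat_comb_mult:
  assumes A: "A \<in> carrier_mat d d" and f: "\<And>\<nu>. \<nu> < m \<Longrightarrow> f \<nu> \<in> carrier_mat d d"
  shows "mat_comb d m f v * A = mat_comb d m (\<lambda>\<nu>. f \<nu> * A) v"
proof -
  have f': "\<And>\<nu>. \<nu> < m \<Longrightarrow> mat_adjoint (f \<nu>) \<in> carrier_mat d d" using f by simp
  have "mat_comb d m f v * A = mat_adjoint (mat_adjoint A * mat_adjoint (mat_comb d m f v))"
    using A by (simp add: mat_adjoint_mult[of _ d d _ d])
  also have "\<dots> = mat_adjoint (mat_comb d m (\<lambda>\<nu>. mat_adjoint A * mat_adjoint (f \<nu>)) v)"
    using A f f' by (simp add: mat_adjoint_mat_comb mult_mat_comb)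
  also have "\<dots> = mat_comb d m (\<lambda>\<nu>. mat_adjoint (mat_adjoint A * mat_adjoint (f \<nu>))) v"
    using A f' by (intro mat_adjoint_mat_comb) (auto intro!: mult_carrier_mat[where n = d])
  also have "\<dots> = mat_comb d m (\<lambda>\<nu>. f \<nu> * A) v"
    using A f by (intro mat_comb_cong) (simp_all add: mat_adjoint_mult[of _ d d _ d])
  finally show ?thesis .
qed

lemma mat_comb_sandwich:
  assumes "A \<in> carrier_mat d d" "B \<in> carrier_mat d d" "\<And>\<nu>. \<nu> < m \<Longrightarrow> f \<nu> \<in> carrier_mat d d"
  shows "A * mat_comb d m f v * B = mat_comb d m (\<lambda>\<nu>. A * f \<nu> * B) v"
  using assms by (simp add: mult_mat_comb mat_comb_mult mult_carrier_mat[of _ d d])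

text \<open>Substituting one combination into another multiplies a coefficient vector by a
  coefficient matrix. This is how composed conjugations turn into matrix products.\<close>

lemma mat_comb_mat_comb:
  "mat_comb d m (\<lambda>\<nu>. mat_comb d m f (w \<nu>)) v = mat_comb d m f (\<lambda>\<rho>. \<Sum>\<nu><m. v \<nu> * w \<nu> \<rho>)"
proof (rule eq_matI)
  fix a b assume "a < dim_row (mat_comb d m f (\<lambda>\<rho>. \<Sum>\<nu><m. v \<nu> * w \<nu> \<rho>))" "b < dim_col (mat_comb d m f (\<lambda>\<rho>. \<Sum>\<nu><m. v \<nu> * w \<nu> \<rho>))"
  then have ab: "a < d" "b < d" by auto
  have "(\<Sum>\<nu><m. complex_of_real (v \<nu>) * (\<Sum>\<rho><m. complex_of_real (w \<nu> \<rho>) * f \<rho> $$ (a, b)))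
    = (\<Sum>\<nu><m. \<Sum>\<rho><m. complex_of_real (v \<nu>) * (complex_of_real (w \<nu> \<rho>) * f \<rho> $$ (a, b)))"
    by (simp add: sum_distrib_left)
  also have "\<dots> = (\<Sum>\<rho><m. \<Sum>\<nu><m. complex_of_real (v \<nu>) * (complex_of_real (w \<nu> \<rho>) * f \<rho> $$ (a, b)))"
    by (rule sum.swap)
  also have "\<dots> = (\<Sum>\<rho><m. complex_of_real (\<Sum>\<nu><m. v \<nu> * w \<nu> \<rho>) * f \<rho> $$ (a, b))"
    by (simp add: sum_distrib_right mult.assoc)
  finally show "mat_comb d m (\<lambda>\<nu>. mat_comb d m f (w \<nu>)) v $$ (a, b) = mat_comb d m f (\<lambda>\<rho>. \<Sum>\<nu><m. v \<nu> * w \<nu> \<rho>) $$ (a, b)"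
    using ab by simp
qed auto

lemma mat_comb_delta:
  assumes "\<mu> < m" "f \<mu> \<in> carrier_mat d d"
  shows "mat_comb d m f (\<lambda>\<nu>. if \<nu> = \<mu> then 1 else 0) = f \<mu>"
proof (rule eq_matI)
  fix a b assume "a < dim_row (f \<mu>)" "b < dim_col (f \<mu>)"
  then have ab: "a < d" "b < d" using assms by auto
  have "(\<Sum>\<nu><m. complex_of_real (if \<nu> = \<mu> then 1 else 0) * f \<nu> $$ (a, b)) = (\<Sum>\<nu><m. if \<nu> = \<mu> then f \<nu> $$ (a, b) else 0)"
    by (intro sum.cong) auto
  with ab assms show "mat_comb d m f (\<lambda>\<nu>. if \<nu> = \<mu> then 1 else 0) $$ (a, b) = f \<mu> $$ (a, b)"
    by simp
qed (use assms in auto)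

section \<open>The Clifford relations for vectors\<close>

definition majorana_vec :: "nat \<Rightarrow> (nat \<Rightarrow> real) \<Rightarrow> complex mat" where
  "majorana_vec n v = mat_comb (2 ^ n) (2 * n) (majorana n) v"

lemma majorana_vec_carrier [simp]: "majorana_vec n v \<in> carrier_mat (2 ^ n) (2 ^ n)"
  by (simp add: majorana_vec_def)

lemma majorana_comb_eq: "majorana_comb n Q \<mu> = majorana_vec n (\<lambda>\<nu>. Q $$ (\<mu>, \<nu>))"
  by (simp add: majorana_comb_def majorana_vec_def mat_comb_def)

lemma majorana_vec_adjoint: "mat_adjoint (majorana_vec n v) = majorana_vec n v"
  unfolding majorana_vec_def by (subst mat_adjoint_mat_comb) (auto intro!: mat_comb_cong simp: majorana_adjoint)

lemma majorana_anticommutator: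
  assumes "\<mu> < 2 * n" "\<nu> < 2 * n"
  shows "majorana n \<nu> * majorana n \<mu> = (if \<nu> = \<mu> then 2 else 0) \<cdot>\<^sub>m 1\<^sub>m (2 ^ n) - majorana n \<mu> * majorana n \<nu>"
proof (cases "\<nu> = \<mu>")
  case True
  then show ?thesis using assms by (intro eq_matI) (auto simp: majorana_square simp del: index_mult_mat(1))
next
  case False
  have c: "majorana n \<mu> * majorana n \<nu> \<in> carrier_mat (2 ^ n) (2 ^ n)"
    using assms by (intro mult_carrier_mat[where n = "2 ^ n"]) auto
  have "majorana n \<nu> * majorana n \<mu> = - 1 \<cdot>\<^sub>m (majorana n \<mu> * majorana n \<nu>)"
    using majorana_anticommute[OF assms(2,1) False] by (simp add: commute_up_to_def)
  also have "\<dots> = (if \<nu> = \<mu> then 2 else 0) \<cdot>\<^sub>m 1\<^sub>m (2 ^ n) - majorana n \<mu> * majorana n \<nu>"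
    using c False by (intro eq_matI) (auto simp del: index_mult_mat)
  finally show ?thesis .
qed

lemma majorana_vec_anticommutator:
  assumes "\<mu> < 2 * n"
  shows "majorana_vec n v * majorana n \<mu>
    = complex_of_real (2 * v \<mu>) \<cdot>\<^sub>m 1\<^sub>m (2 ^ n) - majorana n \<mu> * majorana_vec n v"
proof (rule eq_matI)
  fix a b
  assume "a < dim_row (complex_of_real (2 * v \<mu>) \<cdot>\<^sub>m 1\<^sub>m (2 ^ n) - majorana n \<mu> * majorana_vec n v)"
    "b < dim_col (complex_of_real (2 * v \<mu>) \<cdot>\<^sub>m 1\<^sub>m (2 ^ n) - majorana n \<mu> * majorana_vec n v)"
  moreover have m: "majorana n \<mu> \<in> carrier_mat (2 ^ n) (2 ^ n)" using assms by simp
  ultimately have ab: "a < 2 ^ n" "b < 2 ^ n" by (auto simp: majorana_vec_def)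
  have "(majorana_vec n v * majorana n \<mu>) $$ (a, b) = (\<Sum>\<nu><2 * n. complex_of_real (v \<nu>) * (majorana n \<nu> * majorana n \<mu>) $$ (a, b))"
    using ab m unfolding majorana_vec_def by (subst mat_comb_mult) auto
  also have "\<dots> = (\<Sum>\<nu><2 * n. (if \<nu> = \<mu> then complex_of_real (v \<nu>) * (2 * 1\<^sub>m (2 ^ n) $$ (a, b)) else 0)
      - complex_of_real (v \<nu>) * (majorana n \<mu> * majorana n \<nu>) $$ (a, b))"
  proof (rule sum.cong)
    fix \<nu> assume "\<nu> \<in> {..<2 * n}"
    then have \<nu>: "\<nu> < 2 * n" by simp
    have c: "majorana n \<mu> * majorana n \<nu> \<in> carrier_mat (2 ^ n) (2 ^ n)"
      using assms \<nu> by (intro mult_carrier_mat[where n = "2 ^ n"]) auto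
    show "complex_of_real (v \<nu>) * (majorana n \<nu> * majorana n \<mu>) $$ (a, b)
      = (if \<nu> = \<mu> then complex_of_real (v \<nu>) * (2 * 1\<^sub>m (2 ^ n) $$ (a, b)) else 0)
      - complex_of_real (v \<nu>) * (majorana n \<mu> * majorana n \<nu>) $$ (a, b)"
      unfolding majorana_anticommutator[OF assms \<nu>]
      using c ab by (simp add: right_diff_distrib del: index_mult_mat)
  qed simp
  also have "\<dots> = complex_of_real (2 * v \<mu>) * 1\<^sub>m (2 ^ n) $$ (a, b)
      - (\<Sum>\<nu><2 * n. complex_of_real (v \<nu>) * (majorana n \<mu> * majorana n \<nu>) $$ (a, b))"
    using assms by (simp add: sum_subtractf)
  also have "(\<Sum>\<nu><2 * n. complex_of_real (v \<nu>) * (majorana n \<mu> * majorana n \<nu>) $$ (a, b))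
      = (majorana n \<mu> * majorana_vec n v) $$ (a, b)"
    using ab m unfolding majorana_vec_def by (subst mult_mat_comb) auto
  finally show "(majorana_vec n v * majorana n \<mu>) $$ (a, b)
    = (complex_of_real (2 * v \<mu>) \<cdot>\<^sub>m 1\<^sub>m (2 ^ n) - majorana n \<mu> * majorana_vec n v) $$ (a, b)"
    using ab m by (simp add: majorana_vec_def del: index_mult_mat(1))
qed (simp_all add: majorana_vec_def carrier_matD[OF majorana_carrier[OF assms]])

text \<open>Let V be the operator of \<open>v\<close>. Expanding the right or the left factor of V *
  V and exchanging the factors by the Clifford relation gives V^2 = 2 |v|^2 - V^2, hence V^2 = 1 for
  a unit vector.\<close>

lemma majorana_vec_square:
  assumes "(\<Sum>\<mu><2 * n. v \<mu> * v \<mu>) = 1"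
  shows "majorana_vec n v * majorana_vec n v = 1\<^sub>m (2 ^ n)"
proof (rule eq_matI)
  fix a b assume "a < dim_row (1\<^sub>m (2 ^ n) :: complex mat)" "b < dim_col (1\<^sub>m (2 ^ n) :: complex mat)"
  then have ab: "a < 2 ^ n" "b < 2 ^ n" by auto
  let ?V = "majorana_vec n v"
  have 1: "(?V * ?V) $$ (a, b) = (\<Sum>\<mu><2 * n. complex_of_real (v \<mu>) * (?V * majorana n \<mu>) $$ (a, b))"
    using ab mult_mat_comb[of ?V "2 ^ n" "2 * n" "majorana n" v] by (simp add: majorana_vec_def)
  have 2: "(?V * ?V) $$ (a, b) = (\<Sum>\<mu><2 * n. complex_of_real (v \<mu>) * (majorana n \<mu> * ?V) $$ (a, b))"
    using ab mat_comb_mult[of ?V "2 ^ n" "2 * n" "majorana n" v] by (simp add: majorana_vec_def)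
  have "(?V * ?V) $$ (a, b) = (\<Sum>\<mu><2 * n. complex_of_real (v \<mu> * v \<mu>) * (2 * 1\<^sub>m (2 ^ n) $$ (a, b))
      - complex_of_real (v \<mu>) * (majorana n \<mu> * ?V) $$ (a, b))"
    unfolding 1
  proof (rule sum.cong)
    fix \<mu> assume "\<mu> \<in> {..<2 * n}"
    then have \<mu>: "\<mu> < 2 * n" by simp
    have c: "majorana n \<mu> * ?V \<in> carrier_mat (2 ^ n) (2 ^ n)"
      using \<mu> by (intro mult_carrier_mat[where n = "2 ^ n"]) auto
    show "complex_of_real (v \<mu>) * (?V * majorana n \<mu>) $$ (a, b)
      = complex_of_real (v \<mu> * v \<mu>) * (2 * 1\<^sub>m (2 ^ n) $$ (a, b)) - complex_of_real (v \<mu>) * (majorana n \<mu> * ?V) $$ (a, b)"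
      unfolding majorana_vec_anticommutator[OF \<mu>]
      using c ab by (simp add: right_diff_distrib del: index_mult_mat)
  qed simp
  also have "\<dots> = complex_of_real (\<Sum>\<mu><2 * n. v \<mu> * v \<mu>) * (2 * 1\<^sub>m (2 ^ n) $$ (a, b)) - (?V * ?V) $$ (a, b)"
    unfolding 2 by (simp only: sum_subtractf of_real_sum sum_distrib_right)
  finally show "(?V * ?V) $$ (a, b) = 1\<^sub>m (2 ^ n) $$ (a, b)" unfolding assms by simp
qed (auto simp: majorana_vec_def)

text \<open>Moving the left factor past \<open>majorana n \<mu>\<close> produces a scalar and a
  sign; the two copies of \<open>majorana_vec n v\<close> then meet and square to 1. The coefficient
  vector is 2 v_\<mu> v - e_\<mu>, with e_\<mu> the basis vector.\<close>

lemma majorana_vec_sandwich: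
  assumes "(\<Sum>\<mu><2 * n. v \<mu> * v \<mu>) = 1" and \<mu>: "\<mu> < 2 * n"
  shows "majorana_vec n v * majorana n \<mu> * majorana_vec n v
    = majorana_vec n (\<lambda>\<nu>. 2 * v \<mu> * v \<nu> - (if \<nu> = \<mu> then 1 else 0))"
proof -
  let ?V = "majorana_vec n v"
  have m: "majorana n \<mu> \<in> carrier_mat (2 ^ n) (2 ^ n)" using \<mu> by simp
  have "?V * majorana n \<mu> * ?V = (complex_of_real (2 * v \<mu>) \<cdot>\<^sub>m 1\<^sub>m (2 ^ n) - majorana n \<mu> * ?V) * ?V"
    by (simp only: majorana_vec_anticommutator[OF \<mu>])
  also have "\<dots> = complex_of_real (2 * v \<mu>) \<cdot>\<^sub>m 1\<^sub>m (2 ^ n) * ?V - majorana n \<mu> * ?V * ?V"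
    using m by (intro minus_mult_distrib_mat[of _ "2 ^ n" "2 ^ n" _ _ "2 ^ n"]) (auto intro!: mult_carrier_mat[where n = "2 ^ n"])
  also have "majorana n \<mu> * ?V * ?V = majorana n \<mu> * (?V * ?V)"
    using m by (intro assoc_mult_mat[of _ "2 ^ n" "2 ^ n" _ "2 ^ n" _ "2 ^ n"]) auto
  also have "\<dots> = majorana n \<mu>"
    using m majorana_vec_square[OF assms(1)] by simp
  also have "complex_of_real (2 * v \<mu>) \<cdot>\<^sub>m 1\<^sub>m (2 ^ n) * ?V = complex_of_real (2 * v \<mu>) \<cdot>\<^sub>m ?V"
    by (subst mult_smult_assoc_mat[of _ "2 ^ n" "2 ^ n" _ "2 ^ n"]) (auto simp: left_mult_one_mat[of _ "2 ^ n" "2 ^ n"])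
  also have "complex_of_real (2 * v \<mu>) \<cdot>\<^sub>m ?V - majorana n \<mu> = majorana_vec n (\<lambda>\<nu>. 2 * v \<mu> * v \<nu> - (if \<nu> = \<mu> then 1 else 0))"
  proof (rule eq_matI)
    fix a b
    assume "a < dim_row (majorana_vec n (\<lambda>\<nu>. 2 * v \<mu> * v \<nu> - (if \<nu> = \<mu> then 1 else 0)))"
      "b < dim_col (majorana_vec n (\<lambda>\<nu>. 2 * v \<mu> * v \<nu> - (if \<nu> = \<mu> then 1 else 0)))"
    then have ab: "a < 2 ^ n" "b < 2 ^ n" by (auto simp: majorana_vec_def)
    have "(\<Sum>\<nu><2 * n. complex_of_real (2 * v \<mu> * v \<nu> - (if \<nu> = \<mu> then 1 else 0)) * majorana n \<nu> $$ (a, b))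
      = (\<Sum>\<nu><2 * n. complex_of_real (2 * v \<mu>) * (complex_of_real (v \<nu>) * majorana n \<nu> $$ (a, b))
          - (if \<nu> = \<mu> then majorana n \<nu> $$ (a, b) else 0))"
      by (intro sum.cong) (auto simp: algebra_simps)
    also have "\<dots> = complex_of_real (2 * v \<mu>) * (\<Sum>\<nu><2 * n. complex_of_real (v \<nu>) * majorana n \<nu> $$ (a, b)) - majorana n \<mu> $$ (a, b)"
      using \<mu> by (simp only: sum_subtractf sum_distrib_left[symmetric]) simp
    finally show "(complex_of_real (2 * v \<mu>) \<cdot>\<^sub>m ?V - majorana n \<mu>) $$ (a, b)
        = majorana_vec n (\<lambda>\<nu>. 2 * v \<mu> * v \<nu> - (if \<nu> = \<mu> then 1 else 0)) $$ (a, b)"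
      using ab m by (simp add: majorana_vec_def)
  qed (use m in \<open>auto simp: majorana_vec_def\<close>)
  finally show ?thesis .
qed

section \<open>Gaussian unitaries from reflections\<close>

lemma orthogonal_groupD:
  assumes "Q \<in> orthogonal_group d"
  shows "Q \<in> carrier_mat d d" "Q\<^sup>T * Q = 1\<^sub>m d" "Q * Q\<^sup>T = 1\<^sub>m d"
    "i < d \<Longrightarrow> j < d \<Longrightarrow> (\<Sum>k<d. Q $$ (k, i) * Q $$ (k, j)) = (if i = j then 1 else 0)"
proof -
  show *: "Q \<in> carrier_mat d d" "Q\<^sup>T * Q = 1\<^sub>m d" "Q * Q\<^sup>T = 1\<^sub>m d" using assms by (auto simp: orthogonal_group_def)
  assume ij: "i < d" "j < d"
  have "(\<Sum>k<d. Q $$ (k, i) * Q $$ (k, j)) = (Q\<^sup>T * Q) $$ (i, j)"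
    using *(1) ij by (auto simp: mat_mult_index_sum simp del: index_mult_mat(1) intro!: sum.cong)
  then show "(\<Sum>k<d. Q $$ (k, i) * Q $$ (k, j)) = (if i = j then 1 else 0)" using * ij by simp
qed

lemma orthogonal_group_mult:
  assumes "P \<in> orthogonal_group d" "Q \<in> orthogonal_group d"
  shows "P * Q \<in> orthogonal_group d"
proof -
  note P = orthogonal_groupD(1-3)[OF assms(1)] and Q = orthogonal_groupD(1-3)[OF assms(2)]
  note assoc_mult_mat[of _ d d _ d _ d, simp]
  have "(P * Q)\<^sup>T * (P * Q) = Q\<^sup>T * ((P\<^sup>T * P) * Q)"
    using P(1) Q(1) by (simp add: transpose_mult[of _ d d _ d])
  moreover have "(P * Q) * (P * Q)\<^sup>T = P * ((Q * Q\<^sup>T) * P\<^sup>T)"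
    using P(1) Q(1) by (simp add: transpose_mult[of _ d d _ d])
  ultimately show ?thesis using P Q by (simp add: orthogonal_group_def left_mult_one_mat[of _ d d])
qed

section \<open>Reflections generate the orthogonal group\<close>

definition householder :: "nat \<Rightarrow> (nat \<Rightarrow> real) \<Rightarrow> real mat" where
  "householder d v = mat d d (\<lambda>(i, j). (if i = j then 1 else 0) - 2 * v i * v j)"

lemma householder_carrier [simp]: "householder d v \<in> carrier_mat d d"
  by (simp add: householder_def)

lemma householder_mult_index:
  assumes "Q \<in> carrier_mat d d" "i < d" "j < d"
  shows "(householder d v * Q) $$ (i, j) = Q $$ (i, j) - 2 * v i * (\<Sum>k<d. v k * Q $$ (k, j))"
proof -
  have "(householder d v * Q) $$ (i, j) = (\<Sum>k<d. (if k = i then Q $$ (k, j) else 0) - 2 * v i * (v k * Q $$ (k, j)))"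
    using assms by (auto simp: mat_mult_index_sum householder_def algebra_simps simp del: index_mult_mat(1) intro!: sum.cong)
  also have "\<dots> = Q $$ (i, j) - 2 * v i * (\<Sum>k<d. v k * Q $$ (k, j))"
    using assms by (simp add: sum_subtractf sum_distrib_left)
  finally show ?thesis .
qed

lemma householder_involution:
  assumes "(\<Sum>k<d. v k * v k) = 1"
  shows "householder d v * householder d v = 1\<^sub>m d"
proof (rule eq_matI)
  fix i j assume "i < dim_row (1\<^sub>m d :: real mat)" "j < dim_col (1\<^sub>m d :: real mat)"
  then have ij: "i < d" "j < d" by auto
  have "(\<Sum>k<d. v k * householder d v $$ (k, j)) = (\<Sum>k<d. (if k = j then v k else 0) - 2 * v j * (v k * v k))"
    using ij by (intro sum.cong) (auto simp: householder_def algebra_simps)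
  also have "\<dots> = - v j" using ij assms by (simp add: sum_subtractf sum_distrib_left[symmetric])
  finally have "(householder d v * householder d v) $$ (i, j) = householder d v $$ (i, j) - 2 * v i * - v j"
    using ij by (simp add: householder_mult_index del: index_mult_mat)
  then show "(householder d v * householder d v) $$ (i, j) = 1\<^sub>m d $$ (i, j)"
    using ij by (simp add: householder_def del: index_mult_mat)
qed (auto simp: householder_def)

lemma householder_orthogonal:
  assumes "(\<Sum>k<d. v k * v k) = 1"
  shows "householder d v \<in> orthogonal_group d"
proof -
  have "(householder d v)\<^sup>T = householder d v" by (rule eq_matI) (auto simp: householder_def)
  then show ?thesis using householder_involution[OF assms] by (simp add: orthogonal_group_def)
qed

text \<open>Cartan--Dieudonne: if the first \<open>m\<close> columns of \<open>Q\<close> are standard basis vectors, then the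
  reflection exchanging column \<open>m\<close> and the basis vector \<open>e\<^sub>m\<close> fixes these columns.\<close>

lemma orthogonal_group_induct [consumes 1, case_names one reflect]:
  assumes "Q \<in> orthogonal_group d"
    and one: "P (1\<^sub>m d)"
    and reflect: "\<And>v R. (\<Sum>k<d. v k * v k) = 1 \<Longrightarrow> R \<in> orthogonal_group d \<Longrightarrow> P R \<Longrightarrow> P (householder d v * R)"
  shows "P Q"
proof -
  \<comment> \<open>The number \<open>l\<close> counts the trailing columns that may still differ
    from standard basis vectors. For \<open>l = 0\<close> the matrix is the identity, and
    \<open>l = d\<close> imposes nothing.\<close>
  have "P Q" if "l \<le> d" "Q \<in> orthogonal_group d"
    "\<And>i j. i < d \<Longrightarrow> j < d - l \<Longrightarrow> Q $$ (i, j) = (if i = j then 1 else 0)" for l Q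
    using that
  proof (induction l arbitrary: Q)
    case 0
    have "Q = 1\<^sub>m d" using orthogonal_groupD(1)[OF 0(2)] 0(3) by (intro eq_matI) auto
    with one show ?case by simp
  next
    case (Suc l)
    define m where "m = d - Suc l"
    have m: "m < d" "d - l = Suc m" using Suc.prems by (auto simp: m_def)
    note Q = orthogonal_groupD[OF Suc.prems(2)]
    have fixed: "Q $$ (i, j) = (if i = j then 1 else 0)" if "i < d" "j < m" for i j
      using Suc.prems(3) that by (simp add: m_def)
    \<comment> \<open>The normal of the reflection is the difference of column \<open>m\<close> and
      the basis vector. If it vanishes, there is no reflection to apply, and column \<open>m\<close>
      is already standard.\<close>
    define w where "w i = Q $$ (i, m) - (if i = m then 1 else 0)" for i
    define r where "r = (\<Sum>i<d. w i * w i)"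
    have delta: "(\<Sum>i<d. (if i = j then 1 else 0) * f i) = f j" if "j < d" for f :: "nat \<Rightarrow> real" and j
    proof -
      have "(\<Sum>i<d. (if i = j then 1 else 0) * f i) = (\<Sum>i<d. if i = j then f i else 0)"
        by (intro sum.cong) auto
      with that show ?thesis by simp
    qed
    show ?case
    proof (cases "r = 0")
      case True
      then have "w i = 0" if "i < d" for i
        using that by (auto simp: r_def sum_nonneg_eq_0_iff)
      then have "Q $$ (i, j) = (if i = j then 1 else 0)" if "i < d" "j < d - l" for i j
        using that fixed[of i j] m by (cases "j = m") (auto simp: w_def)
      then show ?thesis using Suc.IH[of Q] Suc.prems by simp
    next
      case False
      have "0 \<le> r" by (auto simp: r_def intro: sum_nonneg)
      with False have r: "r > 0" by simp
      define v where "v i = w i / sqrt r" for i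
      define H where "H = householder d v"
      have vv: "(\<Sum>i<d. v i * v i) = 1"
        using r by (simp add: v_def r_def[symmetric] sum_divide_distrib[symmetric])
      have wQ: "(\<Sum>k<d. w k * Q $$ (k, j)) = (if j = m then 1 else 0) - Q $$ (m, j)" if "j < d" for j
      proof -
        have "(\<Sum>k<d. w k * Q $$ (k, j)) = (\<Sum>k<d. Q $$ (k, m) * Q $$ (k, j) - (if k = m then 1 else 0) * Q $$ (k, j))"
          by (intro sum.cong) (auto simp: w_def algebra_simps)
        also have "\<dots> = (\<Sum>k<d. Q $$ (k, m) * Q $$ (k, j)) - Q $$ (m, j)"
          unfolding sum_subtractf using delta[of m "\<lambda>k. Q $$ (k, j)"] m by simp
        finally show ?thesis using Q(4)[of m j] m that by auto
      qed
      \<comment> \<open>The squared distance of two unit vectors is 2 minus twice their inner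
        product. This is exactly what cancels the denominator in column \<open>m\<close> of
        \<open>H * Q\<close>.\<close>
      have "r = (\<Sum>k<d. w k * Q $$ (k, m) - (if k = m then 1 else 0) * w k)"
        unfolding r_def by (intro sum.cong) (auto simp: w_def algebra_simps)
      also have "\<dots> = (1 - Q $$ (m, m)) - w m"
        unfolding sum_subtractf using delta[of m w] wQ[of m] m by simp
      finally have r2: "r = 2 * (1 - Q $$ (m, m))" by (simp add: w_def)
      have HQ: "(H * Q) $$ (i, j) = Q $$ (i, j) - 2 * w i * (\<Sum>k<d. w k * Q $$ (k, j)) / r" if "i < d" "j < d" for i j
      proof -
        have "v i * (\<Sum>k<d. v k * Q $$ (k, j)) = w i * (\<Sum>k<d. w k * Q $$ (k, j)) / r"
          using r by (simp add: v_def sum_divide_distrib[symmetric])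
        then show ?thesis using householder_mult_index[OF Q(1) that, of v] by (simp add: H_def mult.assoc)
      qed
      have "(H * Q) $$ (i, j) = (if i = j then 1 else 0)" if ij: "i < d" "j < d - l" for i j
      proof (cases "j = m")
        case True
        have "2 * w i * (1 - Q $$ (m, m)) = w i * r" by (simp add: r2)
        then have "2 * w i * (1 - Q $$ (m, m)) / r = w i"
          using False by (simp only: nonzero_mult_div_cancel_right not_False_eq_True)
        then show ?thesis using HQ[of i m] ij m wQ[of m] True by (auto simp: w_def)
      next
        case False
        \<comment> \<open>Column \<open>j\<close> is a basis vector orthogonal to column
          \<open>m\<close> and to the basis vector of index \<open>m\<close>, hence to
          \<open>w\<close>; the reflection leaves it in place.\<close>
        then have "j < m" using ij m by simp
        then show ?thesis using HQ[of i j] ij m wQ[of j] fixed[of i j] fixed[of m j] by auto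
      qed
      moreover have H: "H \<in> orthogonal_group d" unfolding H_def by (rule householder_orthogonal[OF vv])
      ultimately have "P (H * Q)"
        using Suc.prems by (intro Suc.IH orthogonal_group_mult) auto
      \<comment> \<open>The induction hypothesis holds for \<open>H * Q\<close>; reflecting once
        more recovers \<open>Q\<close>, as \<open>H\<close> is an involution.\<close>
      with reflect[OF vv orthogonal_group_mult[OF H Suc.prems(2)]] have "P (H * (H * Q))"
        by (simp add: H_def)
      moreover have "H * (H * Q) = Q"
        using Q(1) householder_involution[OF vv] assoc_mult_mat[of H d d H d Q d]
        by (simp add: H_def)
      ultimately show ?thesis by simp
    qed
  qed
  from this[of d Q] assms(1) show ?thesis by simp
qed

section \<open>Composition and existence of Gaussian unitaries\<close>

lemma unitary_matD:
  assumes "unitary_mat d U"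
  shows "U \<in> carrier_mat d d" "mat_adjoint U * U = 1\<^sub>m d" "U * mat_adjoint U = 1\<^sub>m d"
  using assms by (auto simp: unitary_mat_def)

lemma unitary_mat_mult:
  assumes "unitary_mat d U" "unitary_mat d V"
  shows "unitary_mat d (U * V)"
proof -
  note U = unitary_matD[OF assms(1)] and V = unitary_matD[OF assms(2)]
  note assoc_mult_mat[of _ d d _ d _ d, simp]
  have "mat_adjoint (U * V) * (U * V) = mat_adjoint V * ((mat_adjoint U * U) * V)"
    using U(1) V(1) by (simp add: mat_adjoint_mult[of _ d d _ d])
  moreover have "(U * V) * mat_adjoint (U * V) = U * ((V * mat_adjoint V) * mat_adjoint U)"
    using U(1) V(1) by (simp add: mat_adjoint_mult[of _ d d _ d] mult_carrier_mat[of _ d d])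
  ultimately show ?thesis using U V by (simp add: unitary_mat_def left_mult_one_mat[of _ d d])
qed

lemma gaussian_unitary_of_one: "gaussian_unitary_of n (1\<^sub>m (2 * n)) (1\<^sub>m (2 ^ n))"
proof -
  have "mat_adjoint (1\<^sub>m (2 ^ n)) * majorana n \<mu> * 1\<^sub>m (2 ^ n) = majorana_comb n (1\<^sub>m (2 * n)) \<mu>" if "\<mu> < 2 * n" for \<mu>
  proof -
    have "majorana_comb n (1\<^sub>m (2 * n)) \<mu> = mat_comb (2 ^ n) (2 * n) (majorana n) (\<lambda>\<nu>. if \<nu> = \<mu> then 1 else 0)"
      unfolding majorana_comb_eq majorana_vec_def using that by (intro mat_comb_cong) auto
    also have "\<dots> = majorana n \<mu>" using that by (intro mat_comb_delta) auto
    finally show ?thesis using majorana_carrier[OF that] by simp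
  qed
  then show ?thesis by (simp add: gaussian_unitary_of_def unitary_mat_def orthogonal_group_def)
qed

text \<open>Conjugation by \<open>U\<close> comes first and yields row \<mu> of \<open>Q\<close>;
  conjugation by \<open>V\<close> then replaces every Majorana operator by a row of
  \<open>R\<close>. The order of the factors is therefore the same on both sides.\<close>

lemma gaussian_unitary_of_mult:
  assumes "gaussian_unitary_of n Q U" "gaussian_unitary_of n R V"
  shows "gaussian_unitary_of n (Q * R) (U * V)"
proof -
  let ?d = "2 ^ n"
  note assoc_mult_mat[of _ ?d ?d _ ?d _ ?d, simp]
  have Q: "Q \<in> orthogonal_group (2 * n)" and R: "R \<in> orthogonal_group (2 * n)"
    and UV: "unitary_mat ?d U" "unitary_mat ?d V"
    and gU: "\<And>\<mu>. \<mu> < 2 * n \<Longrightarrow> mat_adjoint U * majorana n \<mu> * U = majorana_comb n Q \<mu>"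
    and gV: "\<And>\<mu>. \<mu> < 2 * n \<Longrightarrow> mat_adjoint V * majorana n \<mu> * V = majorana_comb n R \<mu>"
    using assms by (auto simp: gaussian_unitary_of_def)
  note U = unitary_matD(1)[OF UV(1)] and V = unitary_matD(1)[OF UV(2)]
  have "mat_adjoint (U * V) * majorana n \<mu> * (U * V) = majorana_comb n (Q * R) \<mu>" if \<mu>: "\<mu> < 2 * n" for \<mu>
  proof -
    have m: "majorana n \<mu> \<in> carrier_mat ?d ?d" using \<mu> by simp
    have "mat_adjoint (U * V) * majorana n \<mu> * (U * V) = mat_adjoint V * (mat_adjoint U * majorana n \<mu> * U) * V"
      using U V m by (simp add: mat_adjoint_mult[of _ ?d ?d _ ?d] mult_carrier_mat[of _ ?d ?d])
    also have "\<dots> = mat_comb ?d (2 * n) (\<lambda>\<nu>. mat_adjoint V * majorana n \<nu> * V) (\<lambda>\<nu>. Q $$ (\<mu>, \<nu>))"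
      unfolding gU[OF \<mu>] majorana_comb_eq majorana_vec_def using V by (intro mat_comb_sandwich) auto
    also have "\<dots> = mat_comb ?d (2 * n) (\<lambda>\<nu>. mat_comb ?d (2 * n) (majorana n) (\<lambda>\<rho>. R $$ (\<nu>, \<rho>))) (\<lambda>\<nu>. Q $$ (\<mu>, \<nu>))"
      using gV by (intro mat_comb_cong) (auto simp: majorana_comb_eq majorana_vec_def)
    also have "\<dots> = mat_comb ?d (2 * n) (majorana n) (\<lambda>\<rho>. \<Sum>\<nu><2 * n. Q $$ (\<mu>, \<nu>) * R $$ (\<nu>, \<rho>))"
      by (rule mat_comb_mat_comb)
    also have "\<dots> = majorana_comb n (Q * R) \<mu>"
      unfolding majorana_comb_eq majorana_vec_def
      using \<mu> orthogonal_groupD(1)[OF Q] orthogonal_groupD(1)[OF R]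
      by (intro mat_comb_cong) (auto simp: mat_mult_index_sum simp del: index_mult_mat(1))
    finally show ?thesis .
  qed
  then show ?thesis using Q R UV by (simp add: gaussian_unitary_of_def orthogonal_group_mult unitary_mat_mult)
qed

text \<open>Conjugation by \<open>\<gamma>(v)\<close> alone is the negative of the reflection in \<open>v\<close>; the parity operator
  \<open>Z_string n n\<close> corrects the sign.\<close>

lemma gaussian_unitary_of_householder:
  assumes v: "(\<Sum>k<2 * n. v k * v k) = 1"
  shows "gaussian_unitary_of n (householder (2 * n) v) (majorana_vec n v * Z_string n n)"
proof -
  let ?d = "2 ^ n" and ?V = "majorana_vec n v" and ?S = "Z_string n n"
  have S: "?S \<in> carrier_mat ?d ?d" "?S * ?S = 1\<^sub>m ?d" "mat_adjoint ?S = ?S"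
    by (simp_all add: Z_string_square Z_string_adjoint)
  note V = majorana_vec_square[OF v] majorana_vec_adjoint[of n v]
  note assoc_mult_mat[of _ ?d ?d _ ?d _ ?d, simp]
  have SmS: "?S * majorana n \<mu> * ?S = - 1 \<cdot>\<^sub>m majorana n \<mu>" if \<mu>: "\<mu> < 2 * n" for \<mu>
  proof -
    have m: "majorana n \<mu> \<in> carrier_mat ?d ?d" using \<mu> by simp
    have "?S * majorana n \<mu> * ?S = (- 1 \<cdot>\<^sub>m (majorana n \<mu> * ?S)) * ?S"
      using parity_anticommute[OF \<mu>] by (simp only: commute_up_to_def)
    also have "\<dots> = - 1 \<cdot>\<^sub>m (majorana n \<mu> * (?S * ?S))"
      using m S(1) by (simp add: mult_smult_assoc_mat[of _ ?d ?d _ ?d])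
    finally show ?thesis using m S by simp
  qed
  have "unitary_mat ?d ?V" "unitary_mat ?d ?S" using V S by (simp_all add: unitary_mat_def)
  then have U: "unitary_mat ?d (?V * ?S)" by (rule unitary_mat_mult)
  have "mat_adjoint (?V * ?S) * majorana n \<mu> * (?V * ?S) = majorana_comb n (householder (2 * n) v) \<mu>" if \<mu>: "\<mu> < 2 * n" for \<mu>
  proof -
    have m: "majorana n \<mu> \<in> carrier_mat ?d ?d" using \<mu> by simp
    have "mat_adjoint (?V * ?S) * majorana n \<mu> * (?V * ?S) = ?S * (?V * majorana n \<mu> * ?V) * ?S"
      using m S V(2) by (simp add: mat_adjoint_mult[of _ ?d ?d _ ?d] mult_carrier_mat[of _ ?d ?d])
    also have "\<dots> = mat_comb ?d (2 * n) (\<lambda>\<nu>. ?S * majorana n \<nu> * ?S) (\<lambda>\<nu>. 2 * v \<mu> * v \<nu> - (if \<nu> = \<mu> then 1 else 0))"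
      unfolding majorana_vec_sandwich[OF v \<mu>] unfolding majorana_vec_def using S by (intro mat_comb_sandwich) auto
    also have "\<dots> = mat_comb ?d (2 * n) (\<lambda>\<nu>. - 1 \<cdot>\<^sub>m majorana n \<nu>) (\<lambda>\<nu>. 2 * v \<mu> * v \<nu> - (if \<nu> = \<mu> then 1 else 0))"
      using SmS by (intro mat_comb_cong) auto
    also have "\<dots> = majorana_comb n (householder (2 * n) v) \<mu>"
    proof (rule eq_matI)
      fix a b assume "a < dim_row (majorana_comb n (householder (2 * n) v) \<mu>)" "b < dim_col (majorana_comb n (householder (2 * n) v) \<mu>)"
      then have ab: "a < ?d" "b < ?d" by (auto simp: majorana_comb_def)
      have "complex_of_real (2 * v \<mu> * v \<nu> - (if \<nu> = \<mu> then 1 else 0)) * (- 1 \<cdot>\<^sub>m majorana n \<nu>) $$ (a, b)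
          = complex_of_real (householder (2 * n) v $$ (\<mu>, \<nu>)) * majorana n \<nu> $$ (a, b)" if "\<nu> < 2 * n" for \<nu>
      proof -
        have "(- 1 \<cdot>\<^sub>m majorana n \<nu>) $$ (a, b) = - majorana n \<nu> $$ (a, b)"
          using carrier_matD[OF majorana_carrier[OF that]] ab by simp
        then show ?thesis using that \<mu> by (auto simp: householder_def algebra_simps)
      qed
      then show "mat_comb ?d (2 * n) (\<lambda>\<nu>. - 1 \<cdot>\<^sub>m majorana n \<nu>) (\<lambda>\<nu>. 2 * v \<mu> * v \<nu> - (if \<nu> = \<mu> then 1 else 0)) $$ (a, b)
        = majorana_comb n (householder (2 * n) v) \<mu> $$ (a, b)"
        using ab by (simp add: majorana_comb_def)
    qed (auto simp: majorana_comb_def)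
    finally show ?thesis .
  qed
  then show ?thesis using U householder_orthogonal[OF v] by (simp add: gaussian_unitary_of_def)
qed

lemma gaussian_unitary_of_exists:
  "Q \<in> orthogonal_group (2 * n) \<Longrightarrow> \<exists>G. gaussian_unitary_of n Q G"
proof (induction rule: orthogonal_group_induct)
  case one
  then show ?case using gaussian_unitary_of_one by blast
next
  case (reflect v R)
  then show ?case using gaussian_unitary_of_mult gaussian_unitary_of_householder by blast
qed

section \<open>Expectation values and the normal form\<close>

text \<open>The inverse of \<open>Q\<close> is its transpose, so columns replace rows. The proof
  conjugates the right-hand side with \<open>G\<close>, where orthonormality of the columns leaves
  the single operator \<open>majorana n j\<close>, and then conjugates back.\<close>

lemma gaussian_unitary_of_inverse:
  assumes G: "gaussian_unitary_of n Q G" and j: "j < 2 * n"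
  shows "G * majorana n j * mat_adjoint G = majorana_vec n (\<lambda>\<mu>. Q $$ (\<mu>, j))"
proof -
  let ?d = "2 ^ n" and ?V = "majorana_vec n (\<lambda>\<mu>. Q $$ (\<mu>, j))"
  note assoc_mult_mat[of _ ?d ?d _ ?d _ ?d, simp]
  have Q: "Q \<in> orthogonal_group (2 * n)" and U: "unitary_mat ?d G"
    and g: "\<And>\<mu>. \<mu> < 2 * n \<Longrightarrow> mat_adjoint G * majorana n \<mu> * G = majorana_comb n Q \<mu>"
    using G by (auto simp: gaussian_unitary_of_def)
  note U = unitary_matD[OF U]
  have "mat_adjoint G * ?V * G = mat_comb ?d (2 * n) (\<lambda>\<mu>. mat_adjoint G * majorana n \<mu> * G) (\<lambda>\<mu>. Q $$ (\<mu>, j))"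
    unfolding majorana_vec_def using U by (intro mat_comb_sandwich) auto
  also have "\<dots> = mat_comb ?d (2 * n) (\<lambda>\<mu>. mat_comb ?d (2 * n) (majorana n) (\<lambda>\<rho>. Q $$ (\<mu>, \<rho>))) (\<lambda>\<mu>. Q $$ (\<mu>, j))"
    using g by (intro mat_comb_cong) (auto simp: majorana_comb_eq majorana_vec_def)
  also have "\<dots> = mat_comb ?d (2 * n) (majorana n) (\<lambda>\<rho>. \<Sum>\<mu><2 * n. Q $$ (\<mu>, j) * Q $$ (\<mu>, \<rho>))"
    by (rule mat_comb_mat_comb)
  also have "\<dots> = mat_comb ?d (2 * n) (majorana n) (\<lambda>\<nu>. if \<nu> = j then 1 else 0)"
    using orthogonal_groupD(4)[OF Q j] by (intro mat_comb_cong) auto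
  also have "\<dots> = majorana n j" using j by (intro mat_comb_delta) auto
  finally have "G * majorana n j * mat_adjoint G = G * (mat_adjoint G * ?V * G) * mat_adjoint G" by simp
  also have "\<dots> = (G * mat_adjoint G) * (?V * (G * mat_adjoint G))"
    using U(1) by (simp add: mult_carrier_mat[of _ ?d ?d])
  also have "\<dots> = ?V" unfolding U(3) by (simp add: left_mult_one_mat[of _ ?d ?d] right_mult_one_mat[of _ ?d ?d])
  finally show ?thesis .
qed

section \<open>Expectation values in a pure state\<close>

definition expect :: "complex vec \<Rightarrow> complex mat \<Rightarrow> complex" where
  "expect \<psi> A = (A *\<^sub>v \<psi>) \<bullet>c \<psi>"

lemma mat_trace_mult_ketbra:
  assumes "A \<in> carrier_mat d d" "\<psi> \<in> carrier_vec d"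
  shows "mat_trace (A * ketbra \<psi>) = expect \<psi> A"
  using assms
  by (simp add: expect_def mat_trace_def mat_mult_index_sum cscalar_prod_eq_sum mat_vec_index_sum sum_distrib_right mult.assoc
      del: index_mult_mat(1) index_mult_mat_vec)

lemma expect_diff:
  assumes "A \<in> carrier_mat d d" "B \<in> carrier_mat d d" "\<psi> \<in> carrier_vec d"
  shows "expect \<psi> (A - B) = expect \<psi> A - expect \<psi> B"
  using assms
  by (simp add: expect_def cscalar_prod_eq_sum mat_vec_index_sum sum_distrib_right algebra_simps sum_subtractf
      del: index_mult_mat_vec)

lemma expect_smult:
  assumes "A \<in> carrier_mat d d" "\<psi> \<in> carrier_vec d"
  shows "expect \<psi> (c \<cdot>\<^sub>m A) = c * expect \<psi> A"
proof -
  have "(c \<cdot>\<^sub>m A) *\<^sub>v \<psi> = c \<cdot>\<^sub>v (A *\<^sub>v \<psi>)"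
    using assms by (intro eq_vecI) (auto simp: mat_vec_index_sum sum_distrib_left mult.assoc simp del: index_mult_mat_vec)
  then show ?thesis using assms by (simp add: expect_def)
qed

lemma expect_mat_comb:
  assumes f: "\<And>\<nu>. \<nu> < m \<Longrightarrow> f \<nu> \<in> carrier_mat d d" and \<psi>: "\<psi> \<in> carrier_vec d"
  shows "expect \<psi> (mat_comb d m f v) = (\<Sum>\<nu><m. complex_of_real (v \<nu>) * expect \<psi> (f \<nu>))"
proof -
  have e: "expect \<psi> A = (\<Sum>i<d. \<Sum>k<d. A $$ (i, k) * (\<psi> $ k * cnj (\<psi> $ i)))" if "A \<in> carrier_mat d d" for A
    using that \<psi>
    by (simp add: expect_def cscalar_prod_eq_sum mat_vec_index_sum sum_distrib_right mult.assoc
        del: index_mult_mat_vec)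
  have "expect \<psi> (mat_comb d m f v)
      = (\<Sum>i<d. \<Sum>k<d. \<Sum>\<nu><m. complex_of_real (v \<nu>) * (f \<nu> $$ (i, k) * (\<psi> $ k * cnj (\<psi> $ i))))"
    unfolding e[OF mat_comb_carrier] by (intro sum.cong) (simp_all add: sum_distrib_right mult.assoc)
  also have "\<dots> = (\<Sum>i<d. \<Sum>\<nu><m. \<Sum>k<d. complex_of_real (v \<nu>) * (f \<nu> $$ (i, k) * (\<psi> $ k * cnj (\<psi> $ i))))"
    by (intro sum.cong sum.swap refl)
  also have "\<dots> = (\<Sum>\<nu><m. \<Sum>i<d. \<Sum>k<d. complex_of_real (v \<nu>) * (f \<nu> $$ (i, k) * (\<psi> $ k * cnj (\<psi> $ i))))"
    by (rule sum.swap)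
  also have "\<dots> = (\<Sum>\<nu><m. complex_of_real (v \<nu>) * expect \<psi> (f \<nu>))"
    using f by (intro sum.cong) (simp_all add: e sum_distrib_left)
  finally show ?thesis .
qed

lemma expect_majorana_vec_mult:
  assumes \<psi>: "\<psi> \<in> carrier_vec (2 ^ n)"
  shows "expect \<psi> (majorana_vec n v * majorana_vec n w)
    = (\<Sum>\<mu><2 * n. \<Sum>\<nu><2 * n. complex_of_real (v \<mu> * w \<nu>) * expect \<psi> (majorana n \<mu> * majorana n \<nu>))"
proof -
  let ?d = "2 ^ n"
  have "majorana_vec n v * majorana_vec n w = mat_comb ?d (2 * n) (\<lambda>\<mu>. majorana n \<mu> * majorana_vec n w) v"
    unfolding majorana_vec_def[of n v] by (intro mat_comb_mult) auto
  also have "\<dots> = mat_comb ?d (2 * n) (\<lambda>\<mu>. mat_comb ?d (2 * n) (\<lambda>\<nu>. majorana n \<mu> * majorana n \<nu>) w) v"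
    unfolding majorana_vec_def by (intro mat_comb_cong mult_mat_comb) auto
  finally have *: "majorana_vec n v * majorana_vec n w
    = mat_comb ?d (2 * n) (\<lambda>\<mu>. mat_comb ?d (2 * n) (\<lambda>\<nu>. majorana n \<mu> * majorana n \<nu>) w) v" .
  have c: "majorana n \<mu> * majorana n \<nu> \<in> carrier_mat ?d ?d" if "\<mu> < 2 * n" "\<nu> < 2 * n" for \<mu> \<nu>
    using that by (intro mult_carrier_mat[where n = ?d]) auto
  show ?thesis
    unfolding * using \<psi> c by (simp add: expect_mat_comb sum_distrib_left mult.assoc)
qed

text \<open>The exchange of Heisenberg and Schroedinger picture: conjugating the operator amounts to
  pulling back the state.\<close>

lemma expect_adjoint_mult:
  assumes G: "G \<in> carrier_mat d d" and A: "A \<in> carrier_mat d d" and \<psi>: "\<psi> \<in> carrier_vec d"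
  shows "expect \<psi> (G * A * mat_adjoint G) = expect (mat_adjoint G *\<^sub>v \<psi>) A"
proof -
  have G': "mat_adjoint G \<in> carrier_mat d d" using G by simp
  have v: "mat_adjoint G *\<^sub>v \<psi> \<in> carrier_vec d" using G' \<psi> by (rule mult_mat_vec_carrier)
  have Av: "A *\<^sub>v (mat_adjoint G *\<^sub>v \<psi>) \<in> carrier_vec d" using A v by (rule mult_mat_vec_carrier)
  have "(G * A * mat_adjoint G) *\<^sub>v \<psi> = (G * A) *\<^sub>v (mat_adjoint G *\<^sub>v \<psi>)"
    using G A by (intro assoc_mult_mat_vec[OF _ G' \<psi>] mult_carrier_mat)
  also have "\<dots> = G *\<^sub>v (A *\<^sub>v (mat_adjoint G *\<^sub>v \<psi>))"
    by (rule assoc_mult_mat_vec[OF G A v])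
  finally show ?thesis
    unfolding expect_def using cscalar_prod_adjoint[OF G Av \<psi>] by simp
qed

section \<open>Entries of the normal block matrix\<close>

lemma diag_block_mat_2_index:
  assumes "set As \<subseteq> carrier_mat 2 2" "k < length As"
  shows "diag_block_mat As $$ (2 * k, 2 * k + 1) = (As ! k) $$ (0, 1)"
  using assms
proof (induction As arbitrary: k)
  case (Cons A As)
  have dim: "dim_row (diag_block_mat As) = 2 * length As" "dim_col (diag_block_mat As) = 2 * length As"
    unfolding dim_diag_block_mat using Cons.prems(1) by (induction As) auto
  have A: "dim_row A = 2" "dim_col A = 2" using Cons.prems(1) by auto
  have block: "diag_block_mat (A # As) $$ (i, j)
      = (if i < 2 then if j < 2 then A $$ (i, j) else 0 else if j < 2 then 0 else diag_block_mat As $$ (i - 2, j - 2))"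
    if "i < 2 + 2 * length As" "j < 2 + 2 * length As" for i j
    using that A dim by (simp add: Let_def)
  show ?case
  proof (cases k)
    case 0
    with block[of 0 1] show ?thesis by simp
  next
    case (Suc l)
    with Cons.prems block[of "2 * k" "2 * k + 1"] Cons.IH[of l] show ?thesis by simp
  qed
qed simp

definition skew_block :: "real \<Rightarrow> real mat" where
  "skew_block x = mat_of_rows_list 2 [[0, x], [- x, 0]]"

lemma skew_block: "skew_block x \<in> carrier_mat 2 2" "skew_block x $$ (0, 1) = x"
  by (auto simp: skew_block_def mat_of_rows_list_def)

lemma normal_block_eq: "normal_block n lam = diag_block_mat (map (\<lambda>j. skew_block (lam j)) [1..<n + 1])"
  by (simp only: normal_block_def skew_block_def)

lemma normal_block_carrier: "normal_block n lam \<in> carrier_mat (2 * n) (2 * n)"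
proof -
  have "dim_row (diag_block_mat (map (\<lambda>j. skew_block (lam j)) xs)) = 2 * length xs"
    "dim_col (diag_block_mat (map (\<lambda>j. skew_block (lam j)) xs)) = 2 * length xs" for xs
    unfolding dim_diag_block_mat by (induction xs) (simp_all add: carrier_matD[OF skew_block(1)])
  from this[of "[1..<n + 1]"] show ?thesis unfolding normal_block_eq carrier_mat_def by (simp del: upt_Suc)
qed

text \<open>Blocks are counted from 0 and the normal eigenvalues from 1, whence the shift.\<close>

lemma normal_block_index:
  assumes "k < n"
  shows "normal_block n lam $$ (2 * k, 2 * k + 1) = lam (k + 1)"
proof -
  have "normal_block n lam $$ (2 * k, 2 * k + 1) = (map (\<lambda>j. skew_block (lam j)) [1..<n + 1] ! k) $$ (0, 1)"
    unfolding normal_block_eq using assms skew_block(1) by (intro diag_block_mat_2_index) (auto simp del: upt_Suc)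
  also have "map (\<lambda>j. skew_block (lam j)) [1..<n + 1] ! k = skew_block (lam (k + 1))"
    using assms by (simp del: upt_Suc)
  finally show ?thesis by (simp only: skew_block(2))
qed

text \<open>The entry of Q^T C Q at (2 k, 2 k + 1) is bilinear in two columns of \<open>Q\<close>,
  so it is expressed by expectations in \<psi> of products of the two column combinations. Pulled
  back by \<open>G\<close>, these become the products of the two Majorana operators of qubit
  \<open>k\<close>, that is, Z up to a factor \<i> or - \<i>.\<close>

lemma expect_Z_eq_normal_eigenvalue:
  assumes nf: "normal_form n (correlation_matrix n (ketbra \<psi>)) Q lam"
    and G: "gaussian_unitary_of n Q G" and \<psi>: "\<psi> \<in> carrier_vec (2 ^ n)" and k: "k < n"
  shows "Re (expect (mat_adjoint G *\<^sub>v \<psi>) (on_qubit n k pauli_Z)) = lam (k + 1)"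
proof -
  let ?d = "2 ^ n" and ?a = "2 * k" and ?b = "2 * k + 1" and ?C = "correlation_matrix n (ketbra \<psi>)"
  let ?A = "majorana_vec n (\<lambda>\<mu>. Q $$ (\<mu>, ?a))" and ?B = "majorana_vec n (\<lambda>\<mu>. Q $$ (\<mu>, ?b))"
  define e where "e \<mu> \<nu> = expect \<psi> (majorana n \<mu> * majorana n \<nu>)" for \<mu> \<nu>
  define z where "z = expect (mat_adjoint G *\<^sub>v \<psi>) (on_qubit n k pauli_Z)"
  note assoc_mult_mat[of _ ?d ?d _ ?d _ ?d, simp]
  have ab: "?a < 2 * n" "?b < 2 * n" using k by auto
  have Q: "Q \<in> orthogonal_group (2 * n)" and C: "?C = Q * normal_block n lam * Q\<^sup>T"
    using nf by (auto simp: normal_form_def)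
  have Gu: "unitary_mat ?d G" using G by (simp add: gaussian_unitary_of_def)
  note Gu = unitary_matD[OF Gu]
  have GG: "(G * M * mat_adjoint G) * (G * N * mat_adjoint G) = G * (M * N) * mat_adjoint G"
    if "M \<in> carrier_mat ?d ?d" "N \<in> carrier_mat ?d ?d" for M N
  proof -
    have "(G * M * mat_adjoint G) * (G * N * mat_adjoint G) = G * (M * ((mat_adjoint G * G) * (N * mat_adjoint G)))"
      using that Gu(1) by (simp add: mult_carrier_mat[of _ ?d ?d])
    also have "\<dots> = G * (M * N) * mat_adjoint G"
      unfolding Gu(2) using that Gu(1) by (simp add: mult_carrier_mat[of _ ?d ?d] left_mult_one_mat[of _ ?d ?d])
    finally show ?thesis .
  qed
  have Z: "on_qubit n k pauli_Z \<in> carrier_mat ?d ?d" using k by simp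
  have G\<psi>: "mat_adjoint G *\<^sub>v \<psi> \<in> carrier_vec ?d"
    using Gu(1) \<psi> by (intro mult_mat_vec_carrier[where n = ?d]) auto
  have mm: "majorana n \<mu> * majorana n \<nu> \<in> carrier_mat ?d ?d" if "\<mu> < 2 * n" "\<nu> < 2 * n" for \<mu> \<nu>
    using that by (intro mult_carrier_mat[where n = ?d]) auto
  have E: "expect \<psi> (majorana_vec n (\<lambda>\<mu>. Q $$ (\<mu>, i)) * majorana_vec n (\<lambda>\<mu>. Q $$ (\<mu>, j)))
      = expect (mat_adjoint G *\<^sub>v \<psi>) (majorana n i * majorana n j)" if "i < 2 * n" "j < 2 * n" for i j
    unfolding gaussian_unitary_of_inverse[OF G that(1), symmetric] gaussian_unitary_of_inverse[OF G that(2), symmetric]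
      GG[OF majorana_carrier[OF that(1)] majorana_carrier[OF that(2)]]
    by (rule expect_adjoint_mult[OF Gu(1) mm[OF that] \<psi>])
  have AB: "expect \<psi> (?A * ?B) = \<i> * z"
    unfolding E[OF ab] majorana_pair[OF k] using Z G\<psi> by (simp add: expect_smult z_def)
  have "majorana n ?b * majorana n ?a = - 1 \<cdot>\<^sub>m (majorana n ?a * majorana n ?b)"
    using majorana_anticommute[OF ab(2,1)] by (simp add: commute_up_to_def)
  then have BA: "expect \<psi> (?B * ?A) = - \<i> * z"
    unfolding E[OF ab(2,1)] majorana_pair[OF k] using Z G\<psi> by (simp add: expect_smult z_def smult_smult_mat)
  \<comment> \<open>The prefactor of the correlation matrix turns its real part into half an
    imaginary part.\<close>
  have Re_Im: "Re (- \<i> / 2 * x) = Im x / 2" for x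
  proof -
    have "- \<i> / 2 * x = - (\<i> * x) / 2" by simp
    then show ?thesis by (simp only: Re_divide_numeral) simp
  qed
  have Cij: "?C $$ (\<mu>, \<nu>) = Im (e \<mu> \<nu> - e \<nu> \<mu>) / 2" if \<mu>\<nu>: "\<mu> < 2 * n" "\<nu> < 2 * n" for \<mu> \<nu>
  proof -
    have c: "majorana n \<mu> * majorana n \<nu> - majorana n \<nu> * majorana n \<mu> \<in> carrier_mat ?d ?d"
      by (rule minus_carrier_mat[OF mm[OF \<mu>\<nu>(2,1)]])
    have "?C $$ (\<mu>, \<nu>)
      = Im (mat_trace ((majorana n \<mu> * majorana n \<nu> - majorana n \<nu> * majorana n \<mu>) * ketbra \<psi>)) / 2"
      using \<mu>\<nu> unfolding correlation_matrix_def by (simp only: index_mat(1) case_prod_conv Re_Im)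
    then show ?thesis
      unfolding mat_trace_mult_ketbra[OF c \<psi>] expect_diff[OF mm[OF \<mu>\<nu>] mm[OF \<mu>\<nu>(2,1)] \<psi>] e_def .
  qed
  have Cc: "?C \<in> carrier_mat (2 * n) (2 * n)"
    unfolding correlation_matrix_def by (rule mat_carrier)
  have N: "normal_block n lam \<in> carrier_mat (2 * n) (2 * n)" by (rule normal_block_carrier)
  note Qc = orthogonal_groupD[OF Q]
  have "Q\<^sup>T * ?C * Q = (Q\<^sup>T * Q) * (normal_block n lam * (Q\<^sup>T * Q))"
    unfolding C using Qc(1) N
    by (simp add: assoc_mult_mat[of _ "2 * n" "2 * n" _ "2 * n" _ "2 * n"] mult_carrier_mat[of _ "2 * n" "2 * n"])
  also have "\<dots> = normal_block n lam"
    unfolding Qc(2) using N by (simp add: left_mult_one_mat[of _ "2 * n" "2 * n"] right_mult_one_mat[of _ "2 * n" "2 * n"])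
  also have "Q\<^sup>T * ?C * Q = Q\<^sup>T * (?C * Q)"
    by (rule assoc_mult_mat[OF transpose_carrier_mat[THEN iffD2, OF Qc(1)] Cc Qc(1)])
  finally have "normal_block n lam $$ (?a, ?b) = (Q\<^sup>T * (?C * Q)) $$ (?a, ?b)" by simp
  then have "lam (k + 1) = (Q\<^sup>T * (?C * Q)) $$ (?a, ?b)" using normal_block_index[OF k, of lam] by simp
  also have "\<dots> = (\<Sum>\<mu><2 * n. Q $$ (\<mu>, ?a) * (\<Sum>\<nu><2 * n. ?C $$ (\<mu>, \<nu>) * Q $$ (\<nu>, ?b)))"
    using Qc(1) ab Cc by (simp add: mat_mult_index_sum del: index_mult_mat(1))
  \<comment> \<open>The commutator is split into its two terms; each double sum is the expectation
    of one order of the product of \<open>?A\<close> and \<open>?B\<close>.\<close>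
  also have "\<dots> = (\<Sum>\<mu><2 * n. \<Sum>\<nu><2 * n. Im (complex_of_real (Q $$ (\<mu>, ?a) * Q $$ (\<nu>, ?b)) * e \<mu> \<nu>) / 2
      - Im (complex_of_real (Q $$ (\<nu>, ?b) * Q $$ (\<mu>, ?a)) * e \<nu> \<mu>) / 2)"
    unfolding sum_distrib_left
    by (intro sum.cong refl) (simp add: Cij field_simps)
  also have "\<dots> = Im (\<Sum>\<mu><2 * n. \<Sum>\<nu><2 * n. complex_of_real (Q $$ (\<mu>, ?a) * Q $$ (\<nu>, ?b)) * e \<mu> \<nu>) / 2
      - Im (\<Sum>\<mu><2 * n. \<Sum>\<nu><2 * n. complex_of_real (Q $$ (\<nu>, ?b) * Q $$ (\<mu>, ?a)) * e \<nu> \<mu>) / 2"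
    unfolding Im_sum sum_subtractf sum_divide_distrib ..
  also have "(\<Sum>\<mu><2 * n. \<Sum>\<nu><2 * n. complex_of_real (Q $$ (\<nu>, ?b) * Q $$ (\<mu>, ?a)) * e \<nu> \<mu>)
    = expect \<psi> (?B * ?A)"
    unfolding expect_majorana_vec_mult[OF \<psi>] e_def by (rule sum.swap)
  also have "(\<Sum>\<mu><2 * n. \<Sum>\<nu><2 * n. complex_of_real (Q $$ (\<mu>, ?a) * Q $$ (\<nu>, ?b)) * e \<mu> \<nu>)
    = expect \<psi> (?A * ?B)"
    unfolding expect_majorana_vec_mult[OF \<psi>] e_def ..
  finally have "lam (k + 1) = Im (\<i> * z) / 2 - Im (- \<i> * z) / 2" unfolding AB BA .
  also have "\<dots> = Re z" by simp
  finally show ?thesis by (simp add: z_def)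
qed

section \<open>Projection onto the zero state\<close>

text \<open>The first tensor factor carries the most significant digits, so qubit \<open>k\<close>,
  counted from 0, is the binary digit of weight \<open>2 ^ (n - k - 1)\<close> of the index.\<close>

lemma on_qubit_Z_index:
  assumes k: "k < n" and ij: "i < 2 ^ n" "j < 2 ^ n"
  shows "on_qubit n k pauli_Z $$ (i, j) = (if i = j then if even (i div 2 ^ (n - k - 1)) then 1 else - 1 else 0)"
proof -
  define m :: nat where "m = 2 ^ (n - k - 1)"
  have d: "(2::nat) ^ n = 2 ^ k * (2 * m)" using on_qubit_split[OF k] by (simp add: m_def)
  have m0: "m > 0" by (simp add: m_def)
  note ij' = ij[unfolded d]
  have Z: "pauli_Z $$ (x mod 2, y mod 2) = (if x mod 2 = y mod 2 then if even x then 1 else - 1 else 0)" for x y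
    by (cases "even x"; cases "even y") (auto simp: odd_iff_mod_2_eq_one)
  have eq: "i = j \<longleftrightarrow> i div (2 * m) = j div (2 * m) \<and> i div m mod 2 = j div m mod 2 \<and> i mod m = j mod m"
  proof
    assume *: "i div (2 * m) = j div (2 * m) \<and> i div m mod 2 = j div m mod 2 \<and> i mod m = j mod m"
    then have "i div m = j div m" by (metis div_mult_mod_eq mod_mult_div_mod(1))
    with * show "i = j" by (metis div_mult_mod_eq)
  qed simp
  have "on_qubit n k pauli_Z $$ (i, j) = 1\<^sub>m (2 ^ k) $$ (i div (2 * m), j div (2 * m))
      * (pauli_Z $$ (i div m mod 2, j div m mod 2) * 1\<^sub>m m $$ (i mod m, j mod m))"
    using ij' div_mod_less_mult[OF ij'(1)] div_mod_less_mult[OF ij'(2)] unfolding on_qubit_def m_def[symmetric]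
    by (simp add: mod_mult_div_mod)
  also have "\<dots> = (if i = j then if even (i div m) then 1 else - 1 else 0)"
    unfolding Z eq using div_mod_less_mult[OF ij'(1)] div_mod_less_mult[OF ij'(2)] m0 by auto
  finally show ?thesis by (simp add: m_def)
qed

lemma expect_Z:
  assumes k: "k < n" and v: "v \<in> carrier_vec (2 ^ n)"
  shows "Re (expect v (on_qubit n k pauli_Z))
    = (\<Sum>i<2 ^ n. (if even (i div 2 ^ (n - k - 1)) then 1 else - 1) * (cmod (v $ i))\<^sup>2)"
proof -
  have Zv: "(on_qubit n k pauli_Z *\<^sub>v v) $ i = (if even (i div 2 ^ (n - k - 1)) then 1 else - 1) * v $ i"
    if i: "i < 2 ^ n" for i
  proof -
    have "(on_qubit n k pauli_Z *\<^sub>v v) $ i = (\<Sum>j<2 ^ n. on_qubit n k pauli_Z $$ (i, j) * v $ j)"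
      using i v carrier_matD[OF on_qubit_carrier[OF k pauli_carrier(3)]]
      by (simp add: mat_vec_index_sum del: index_mult_mat_vec)
    also have "\<dots> = (\<Sum>j<2 ^ n. if j = i then (if even (i div 2 ^ (n - k - 1)) then 1 else - 1) * v $ i else 0)"
      using i k by (intro sum.cong) (auto simp: on_qubit_Z_index)
    finally show ?thesis using i by simp
  qed
  have "expect v (on_qubit n k pauli_Z)
      = (\<Sum>i<2 ^ n. complex_of_real ((if even (i div 2 ^ (n - k - 1)) then 1 else - 1) * (cmod (v $ i))\<^sup>2))"
    unfolding expect_def cscalar_prod_eq_sum carrier_vecD[OF v]
    by (intro sum.cong refl) (simp add: Zv complex_norm_square del: index_mult_mat_vec of_real_power)
  then show ?thesis by (simp only: Re_sum Re_complex_of_real)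
qed

lemma cscalar_prod_self: "v \<bullet>c v = complex_of_real (\<Sum>i<dim_vec v. (cmod (v $ i))\<^sup>2)"
  by (simp add: cscalar_prod_eq_sum complex_norm_square[symmetric])

text \<open>Serves the union bound through its contrapositive: an index outside the range of the
  projector has an odd digit below \<open>s\<close>.\<close>

lemma power_two_dvd_if_bits_even:
  fixes i :: nat
  shows "(\<And>b. b < s \<Longrightarrow> even (i div 2 ^ b)) \<Longrightarrow> 2 ^ s dvd i"
proof (induction s)
  case (Suc s)
  then have "2 ^ s dvd i" by simp
  then obtain q where "i = 2 ^ s * q" by blast
  with Suc.prems[of s] show ?case by simp
qed simp

section \<open>The zero projector and its outcome probability\<close>

lemma zero_projector_carrier [simp]:
  assumes "t \<le> n" shows "zero_projector n t \<in> carrier_mat (2 ^ n) (2 ^ n)"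
proof -
  have "(2::nat) ^ n = 2 ^ t * 2 ^ (n - t)" using assms by (simp flip: power_add)
  then show ?thesis unfolding zero_projector_def by (simp add: ket_zeros_def)
qed

lemma zero_projector_index:
  assumes t: "t \<le> n" and ij: "i < 2 ^ n" "j < 2 ^ n"
  shows "zero_projector n t $$ (i, j) = (if i = j \<and> i mod 2 ^ (n - t) = 0 then 1 else 0)"
proof -
  define s :: nat where "s = 2 ^ (n - t)"
  have d: "(2::nat) ^ n = 2 ^ t * s" using t by (simp add: s_def flip: power_add)
  note ij' = ij[unfolded d]
  have "zero_projector n t $$ (i, j) = 1\<^sub>m (2 ^ t) $$ (i div s, j div s) * (unit_vec s 0 $ (i mod s) * cnj (unit_vec s 0 $ (j mod s)))"
    unfolding zero_projector_def ket_zeros_def s_def[symmetric]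
    using ij' div_mod_less_mult[OF ij'(1)] div_mod_less_mult[OF ij'(2)] by simp
  also have "\<dots> = (if i div s = j div s then 1 else 0) * ((if i mod s = 0 then 1 else 0) * (if j mod s = 0 then 1 else 0))"
    using div_mod_less_mult[OF ij'(1)] div_mod_less_mult[OF ij'(2)] by (simp add: unit_vec_def)
  also have "\<dots> = (if i = j \<and> i mod s = 0 then 1 else 0)"
  proof -
    have "i = j \<longleftrightarrow> i div s = j div s \<and> i mod s = j mod s" by (metis div_mult_mod_eq)
    then show ?thesis by auto
  qed
  finally show ?thesis by (simp add: s_def)
qed

lemma zero_projector_mult_vec_index:
  assumes t: "t \<le> n" and v: "v \<in> carrier_vec (2 ^ n)" and i: "i < 2 ^ n"
  shows "(zero_projector n t *\<^sub>v v) $ i = (if i mod 2 ^ (n - t) = 0 then v $ i else 0)"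
proof -
  have "(zero_projector n t *\<^sub>v v) $ i = (\<Sum>j<2 ^ n. zero_projector n t $$ (i, j) * v $ j)"
    using i v carrier_matD[OF zero_projector_carrier[OF t]]
    by (simp add: mat_vec_index_sum del: index_mult_mat_vec)
  also have "\<dots> = (\<Sum>j<2 ^ n. if j = i then (if i mod 2 ^ (n - t) = 0 then v $ i else 0) else 0)"
    using i by (intro sum.cong) (auto simp: zero_projector_index[OF t])
  finally show ?thesis using i by simp
qed

text \<open>The projector is diagonal with entries 0 and 1, so projecting one argument of the inner
  product has the same effect as projecting both. The last identity later gives the overlap with the
  projected state.\<close>

lemma outcome_prob_zero_projector:
  assumes t: "t \<le> n" and v: "v \<in> carrier_vec (2 ^ n)"
  shows "outcome_prob (zero_projector n t) v = (\<Sum>i<2 ^ n. if i mod 2 ^ (n - t) = 0 then (cmod (v $ i))\<^sup>2 else 0)"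
    and "(zero_projector n t *\<^sub>v v) \<bullet>c (zero_projector n t *\<^sub>v v) = complex_of_real (outcome_prob (zero_projector n t) v)"
    and "(zero_projector n t *\<^sub>v v) \<bullet>c v = complex_of_real (outcome_prob (zero_projector n t) v)"
proof -
  let ?P = "zero_projector n t"
  have dim: "dim_vec (?P *\<^sub>v v) = 2 ^ n" using zero_projector_carrier[OF t] by simp
  have e: "(?P *\<^sub>v v) \<bullet>c (?P *\<^sub>v v)
      = complex_of_real (\<Sum>i<2 ^ n. if i mod 2 ^ (n - t) = 0 then (cmod (v $ i))\<^sup>2 else 0)"
    unfolding cscalar_prod_self dim
    by (intro arg_cong[where f = complex_of_real] sum.cong) (simp_all add: zero_projector_mult_vec_index[OF t v] del: index_mult_mat_vec)
  then show p: "outcome_prob ?P v = (\<Sum>i<2 ^ n. if i mod 2 ^ (n - t) = 0 then (cmod (v $ i))\<^sup>2 else 0)"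
    by (simp add: outcome_prob_def del: of_real_sum)
  show "(?P *\<^sub>v v) \<bullet>c (?P *\<^sub>v v) = complex_of_real (outcome_prob ?P v)" unfolding e p ..
  have "(?P *\<^sub>v v) \<bullet>c v = (\<Sum>i<2 ^ n. complex_of_real (if i mod 2 ^ (n - t) = 0 then (cmod (v $ i))\<^sup>2 else 0))"
    using v unfolding cscalar_prod_eq_sum
    by (intro sum.cong) (simp_all add: zero_projector_mult_vec_index[OF t v] complex_norm_square del: index_mult_mat_vec of_real_power)
  then show "(?P *\<^sub>v v) \<bullet>c v = complex_of_real (outcome_prob ?P v)" unfolding p of_real_sum .
qed

text \<open>Union bound over the last \<open>n - t\<close> qubits: a basis index outside the range of the projector
  has a nonzero digit among its last \<open>n - t\<close>, and digit \<open>n - k\<close> is 1 with probability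
  \<open>(1 - lam k) / 2\<close>.\<close>

lemma outcome_prob_zero_projector_ge:
  assumes t: "t \<le> n" and v: "v \<in> carrier_vec (2 ^ n)" "v \<bullet>c v = 1"
    and lam: "\<And>k. k < n \<Longrightarrow> Re (expect v (on_qubit n k pauli_Z)) = lam (k + 1)"
  shows "1 - outcome_prob (zero_projector n t) v \<le> (\<Sum>k = t + 1..n. 1 / 2 * (1 - lam k))"
proof -
  have tot: "(\<Sum>i<2 ^ n. (cmod (v $ i))\<^sup>2) = 1"
    using v unfolding cscalar_prod_self by (simp del: of_real_sum)
  have digit: "1 / 2 * (1 - lam k) = (\<Sum>i<2 ^ n. if odd (i div 2 ^ (n - k)) then (cmod (v $ i))\<^sup>2 else 0)"
    if k: "k \<in> {t + 1..n}" for k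
  proof -
    \<comment> \<open>The value \<open>lam k\<close> belongs to qubit \<open>k - 1\<close> counted
      from 0, hence to digit \<open>n - k\<close>.\<close>
    have "k - 1 < n" "n - (k - 1) - 1 = n - k" "k - 1 + 1 = k" using k by auto
    then have "Re (expect v (on_qubit n (k - 1) pauli_Z)) = lam k"
      "Re (expect v (on_qubit n (k - 1) pauli_Z))
        = (\<Sum>i<2 ^ n. (if even (i div 2 ^ (n - k)) then 1 else - 1) * (cmod (v $ i))\<^sup>2)"
      using lam[of "k - 1"] expect_Z[of "k - 1" n v] v(1) by (simp_all only:)
    then have "1 - lam k = (\<Sum>i<2 ^ n. (cmod (v $ i))\<^sup>2)
        - (\<Sum>i<2 ^ n. (if even (i div 2 ^ (n - k)) then 1 else - 1) * (cmod (v $ i))\<^sup>2)"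
      unfolding tot by (simp only:)
    also have "\<dots> = 2 * (\<Sum>i<2 ^ n. if odd (i div 2 ^ (n - k)) then (cmod (v $ i))\<^sup>2 else 0)"
      unfolding sum_subtractf[symmetric] sum_distrib_left by (intro sum.cong) auto
    finally show ?thesis by simp
  qed
  have "1 - outcome_prob (zero_projector n t) v
      = (\<Sum>i<2 ^ n. if i mod 2 ^ (n - t) = 0 then 0 else (cmod (v $ i))\<^sup>2)"
    unfolding tot[symmetric] outcome_prob_zero_projector(1)[OF t v(1)] sum_subtractf[symmetric] by (intro sum.cong) auto
  also have "\<dots> \<le> (\<Sum>i<2 ^ n. \<Sum>k = t + 1..n. if odd (i div 2 ^ (n - k)) then (cmod (v $ i))\<^sup>2 else 0)"
  proof (rule sum_mono)
    fix i :: nat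
    show "(if i mod 2 ^ (n - t) = 0 then 0 else (cmod (v $ i))\<^sup>2)
      \<le> (\<Sum>k = t + 1..n. if odd (i div 2 ^ (n - k)) then (cmod (v $ i))\<^sup>2 else 0)"
    proof (cases "i mod 2 ^ (n - t) = 0")
      case True
      then show ?thesis by (auto intro!: sum_nonneg)
    next
      case False
      then obtain b where b: "b < n - t" "odd (i div 2 ^ b)"
        using power_two_dvd_if_bits_even[of "n - t" i] by (auto simp: mod_eq_0_iff_dvd)
      \<comment> \<open>Digit \<open>b\<close> belongs to the summand \<open>k = n - b\<close>,
        which lies in the range of summation because \<open>b < n - t\<close>. This one summand
        already dominates.\<close>
      have "(cmod (v $ i))\<^sup>2 = (if odd (i div 2 ^ (n - (n - b))) then (cmod (v $ i))\<^sup>2 else 0)"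
        using b by simp
      also have "\<dots> \<le> (\<Sum>k = t + 1..n. if odd (i div 2 ^ (n - k)) then (cmod (v $ i))\<^sup>2 else 0)"
        using b by (intro member_le_sum) auto
      finally show ?thesis using False by simp
    qed
  qed
  also have "\<dots> = (\<Sum>k = t + 1..n. \<Sum>i<2 ^ n. if odd (i div 2 ^ (n - k)) then (cmod (v $ i))\<^sup>2 else 0)"
    by (rule sum.swap)
  also have "\<dots> = (\<Sum>k = t + 1..n. 1 / 2 * (1 - lam k))"
    using digit by (intro sum.cong) auto
  finally show ?thesis .
qed

section \<open>Product states and the post-measurement state\<close>

lemma kron_vec_index [simp]:
  "i < dim_vec v * dim_vec w \<Longrightarrow> (v \<otimes>\<^sub>s w) $ i = v $ (i div dim_vec w) * w $ (i mod dim_vec w)"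
  "dim_vec (v \<otimes>\<^sub>s w) = dim_vec v * dim_vec w"
  unfolding kron_vec_def by auto

lemma kron_vec_cscalar_prod:
  "(v \<otimes>\<^sub>s w) \<bullet>c (v \<otimes>\<^sub>s w) = (v \<bullet>c v) * (w \<bullet>c w)"
proof -
  have "(v \<otimes>\<^sub>s w) \<bullet>c (v \<otimes>\<^sub>s w) = (\<Sum>k<dim_vec v * dim_vec w.
      (v $ (k div dim_vec w) * cnj (v $ (k div dim_vec w))) * (w $ (k mod dim_vec w) * cnj (w $ (k mod dim_vec w))))"
    by (simp add: cscalar_prod_eq_sum mult_ac)
  also have "\<dots> = (\<Sum>i<dim_vec v. \<Sum>j<dim_vec w. (v $ i * cnj (v $ i)) * (w $ j * cnj (w $ j)))"
    by (rule sum_div_mod)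
  also have "\<dots> = (v \<bullet>c v) * (w \<bullet>c w)" by (simp only: cscalar_prod_eq_sum sum_product)
  finally show ?thesis .
qed

lemma ket_zeros_pure: "pure_state m (ket_zeros m)"
proof -
  have "ket_zeros m \<bullet>c ket_zeros m = (\<Sum>i<(2 :: nat) ^ m. if i = 0 then 1 else 0)"
    unfolding cscalar_prod_eq_sum ket_zeros_def by (intro sum.cong) (auto simp: unit_vec_def)
  then show ?thesis by (simp add: pure_state_def ket_zeros_def)
qed

text \<open>Both directions matter: normalization of the projected state passes to its first factor,
  and in return a state on \<open>t\<close> qubits gives one on \<open>n\<close> qubits.\<close>

lemma pure_state_kron_ket_zeros:
  assumes t: "t \<le> n" and \<phi>: "\<phi> \<in> carrier_vec (2 ^ t)"
  shows "pure_state n (\<phi> \<otimes>\<^sub>s ket_zeros (n - t)) \<longleftrightarrow> pure_state t \<phi>"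
proof -
  have "dim_vec (\<phi> \<otimes>\<^sub>s ket_zeros (n - t)) = 2 ^ t * 2 ^ (n - t)"
    using carrier_vecD[OF \<phi>] by (simp add: ket_zeros_def)
  also have "\<dots> = 2 ^ n" using t by (simp flip: power_add)
  finally have "\<phi> \<otimes>\<^sub>s ket_zeros (n - t) \<in> carrier_vec (2 ^ n)" by (rule carrier_vecI)
  moreover have "(\<phi> \<otimes>\<^sub>s ket_zeros (n - t)) \<bullet>c (\<phi> \<otimes>\<^sub>s ket_zeros (n - t)) = \<phi> \<bullet>c \<phi>"
    using ket_zeros_pure[of "n - t"] by (simp add: kron_vec_cscalar_prod pure_state_def)
  ultimately show ?thesis using \<phi> by (simp add: pure_state_def)
qed

lemma post_measurement_zero_projector:
  assumes t: "t \<le> n" and v: "v \<in> carrier_vec (2 ^ n)" and p: "outcome_prob (zero_projector n t) v > 0"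
  obtains \<phi> where "pure_state t \<phi>" "\<phi> \<otimes>\<^sub>s ket_zeros (n - t) = post_measurement (zero_projector n t) v"
    "(post_measurement (zero_projector n t) v) \<bullet>c v = complex_of_real (sqrt (outcome_prob (zero_projector n t) v))"
proof -
  let ?P = "zero_projector n t"
  define p where "p = outcome_prob ?P v"
  define c where "c = complex_of_real (1 / sqrt p)"
  have p0: "p > 0" using p by (simp add: p_def)
  define s :: nat where "s = 2 ^ (n - t)"
  have d: "(2::nat) ^ n = 2 ^ t * s" using t by (simp add: s_def flip: power_add)
  have s0: "s > 0" by (simp add: s_def)
  have Pv: "?P *\<^sub>v v \<in> carrier_vec (2 ^ n)"
    using zero_projector_carrier[OF t] v by (rule mult_mat_vec_carrier)
  have post: "post_measurement ?P v = c \<cdot>\<^sub>v (?P *\<^sub>v v)"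
    by (simp only: post_measurement_def c_def p_def)
  \<comment> \<open>The surviving amplitudes sit at the indices whose last \<open>n - t\<close>
    digits vanish, the multiples of \<open>s\<close>.\<close>
  define \<phi> where "\<phi> = vec (2 ^ t) (\<lambda>i. c * v $ (i * s))"
  have \<phi>: "\<phi> \<in> carrier_vec (2 ^ t)" by (simp add: \<phi>_def)
  have eq: "\<phi> \<otimes>\<^sub>s ket_zeros (n - t) = post_measurement ?P v"
  proof (rule eq_vecI)
    fix i assume "i < dim_vec (post_measurement ?P v)"
    then have i: "i < 2 ^ n" using carrier_matD[OF zero_projector_carrier[OF t]] by (simp add: post)
    then have i': "i < 2 ^ t * s" by (simp add: d)
    have "(\<phi> \<otimes>\<^sub>s ket_zeros (n - t)) $ i = c * v $ (i div s * s) * unit_vec s 0 $ (i mod s)"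
      using i' div_mod_less_mult[OF i'] by (simp add: \<phi>_def ket_zeros_def s_def[symmetric])
    also have "\<dots> = (if i mod s = 0 then c * v $ i else 0)"
    proof -
      have "i div s * s = i" if "i mod s = 0" using div_mult_mod_eq[of i s] that by linarith
      then show ?thesis using div_mod_less_mult[OF i'] by (simp add: unit_vec_def)
    qed
    also have "\<dots> = post_measurement ?P v $ i"
      using i carrier_matD[OF zero_projector_carrier[OF t]] zero_projector_mult_vec_index[OF t v i]
      by (simp add: post s_def del: index_mult_mat_vec)
    finally show "(\<phi> \<otimes>\<^sub>s ket_zeros (n - t)) $ i = post_measurement ?P v $ i" .
  qed (simp add: post \<phi>_def ket_zeros_def carrier_matD[OF zero_projector_carrier[OF t]] d[unfolded s_def, symmetric])
  have "post_measurement ?P v \<bullet>c post_measurement ?P v = c * cnj c * ((?P *\<^sub>v v) \<bullet>c (?P *\<^sub>v v))"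
    unfolding post using Pv by (simp add: cscalar_prod_eq_sum sum_distrib_left mult_ac del: index_mult_mat_vec)
  also have "\<dots> = complex_of_real (1 / sqrt p * (1 / sqrt p) * p)"
    unfolding outcome_prob_zero_projector(2)[OF t v] p_def[symmetric] c_def complex_cnj_complex_of_real
    by (simp only: of_real_mult)
  also have "1 / sqrt p * (1 / sqrt p) * p = 1" using p0 by simp
  finally have "pure_state n (\<phi> \<otimes>\<^sub>s ket_zeros (n - t))"
    unfolding pure_state_def eq using Pv by (simp add: post)
  then have pure: "pure_state t \<phi>" using pure_state_kron_ket_zeros[OF t \<phi>] by simp
  have "post_measurement ?P v \<bullet>c v = c * ((?P *\<^sub>v v) \<bullet>c v)"
    unfolding post by (rule smult_scalar_prod_distrib[OF Pv carrier_vec_conjugate[OF v]])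
  also have "\<dots> = complex_of_real (1 / sqrt p * p)"
    unfolding outcome_prob_zero_projector(3)[OF t v] c_def p_def by simp
  also have "1 / sqrt p * p = sqrt p" using p0 by (simp add: real_div_sqrt)
  finally show ?thesis using that[OF pure eq] by (simp add: p_def)
qed

section \<open>Unitaries on pure states and the final bound\<close>

lemma unitary_pure_state:
  assumes U: "unitary_mat (2 ^ n) U" and v: "pure_state n v"
  shows "pure_state n (U *\<^sub>v v)"
proof -
  let ?d = "2 ^ n"
  note U = unitary_matD[OF U]
  have v': "v \<in> carrier_vec ?d" "v \<bullet>c v = 1" using v by (auto simp: pure_state_def)
  have Uv: "U *\<^sub>v v \<in> carrier_vec ?d" using U(1) v'(1) by (rule mult_mat_vec_carrier)
  have "(U *\<^sub>v v) \<bullet>c (U *\<^sub>v v) = v \<bullet>c (mat_adjoint U *\<^sub>v (U *\<^sub>v v))"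
    by (rule cscalar_prod_adjoint[OF U(1) v'(1) Uv])
  also have "mat_adjoint U *\<^sub>v (U *\<^sub>v v) = (mat_adjoint U * U) *\<^sub>v v"
    by (rule assoc_mult_mat_vec[OF mat_adjoint_carrier[OF U(1)] U(1) v'(1), symmetric])
  finally show ?thesis using Uv v' by (simp add: pure_state_def U(2))
qed

lemma unitary_mat_adjoint: "unitary_mat d U \<Longrightarrow> unitary_mat d (mat_adjoint U)"
  by (simp add: unitary_mat_def)

text \<open>The second part ranges over all \<open>Q\<close> and \<open>G\<close> because neither is
  unique: \<open>Q\<close> need not be determined by the correlation matrix, and \<open>G\<close> is
  fixed only up to a phase. Its condition of positive probability says that a normalized projected
  state exists.\<close>

theorem proposition46:
  fixes n t :: nat and \<psi> :: "complex vec" and lam :: "nat \<Rightarrow> real"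
  assumes t: "t \<in> {1..n}"
    and psi: "pure_state n \<psi>"
    and nf: "normal_eigenvalues n (correlation_matrix n (ketbra \<psi>)) lam"
  shows "(\<exists>\<psi>\<^sub>t. compressible_gaussian_state n t \<psi>\<^sub>t
            \<and> trace_distance (ketbra \<psi>\<^sub>t) (ketbra \<psi>) \<le> sqrt (\<Sum>k = t + 1..n. 1 / 2 * (1 - lam k)))
       \<and> (\<forall>Q. normal_form n (correlation_matrix n (ketbra \<psi>)) Q lam \<longrightarrow>
            (\<exists>G. gaussian_unitary_of n Q G)
          \<and> (\<forall>G. gaussian_unitary_of n Q G
                \<and> outcome_prob (zero_projector n t) (mat_adjoint G *\<^sub>v \<psi>) > 0 \<longrightarrow>
              (\<exists>\<phi>. pure_state t \<phi>
                \<and> \<phi> \<otimes>\<^sub>s ket_zeros (n - t)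
                    = post_measurement (zero_projector n t) (mat_adjoint G *\<^sub>v \<psi>)
                \<and> compressible_gaussian_state n t (G *\<^sub>v (\<phi> \<otimes>\<^sub>s ket_zeros (n - t)))
                \<and> trace_distance (ketbra (G *\<^sub>v (\<phi> \<otimes>\<^sub>s ket_zeros (n - t)))) (ketbra \<psi>)
                    \<le> sqrt (\<Sum>k = t + 1..n. 1 / 2 * (1 - lam k)))))"
proof -
  let ?C = "correlation_matrix n (ketbra \<psi>)" and ?P = "zero_projector n t"
    and ?S = "\<Sum>k = t + 1..n. 1 / 2 * (1 - lam k)"
  have tn: "t \<le> n" using t by simp
  have \<psi>: "\<psi> \<in> carrier_vec (2 ^ n)" "\<psi> \<bullet>c \<psi> = 1" using psi by (auto simp: pure_state_def)
  have G_exists: "\<exists>G. gaussian_unitary_of n Q G" if "normal_form n ?C Q lam" for Q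
    using that gaussian_unitary_of_exists by (auto simp: normal_form_def)
  have compr: "compressible_gaussian_state n t (G *\<^sub>v (\<phi> \<otimes>\<^sub>s ket_zeros (n - t)))"
    if "gaussian_unitary_of n Q G" "pure_state t \<phi>" for Q G \<phi>
    using that by (auto simp: compressible_gaussian_state_def gaussian_unitary_def)
  have pulled_back: "pure_state n (mat_adjoint G *\<^sub>v \<psi>)" if "gaussian_unitary_of n Q G" for Q G
    using that psi by (auto simp: gaussian_unitary_of_def intro: unitary_pure_state unitary_mat_adjoint)
  have prob: "1 - outcome_prob ?P (mat_adjoint G *\<^sub>v \<psi>) \<le> ?S"
    if "normal_form n ?C Q lam" "gaussian_unitary_of n Q G" for Q G
    using pulled_back[OF that(2)] expect_Z_eq_normal_eigenvalue[OF that \<psi>(1)] tn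
    by (intro outcome_prob_zero_projector_ge) (auto simp: pure_state_def)
  \<comment> \<open>The distance depends only on the overlap, and \<open>G\<close> moves to the
    other argument as its adjoint. The vector \<open>u\<close> is left general, since it is applied
    to the projected state and to the state chosen when the probability is zero.\<close>
  have dist: "trace_distance (ketbra (G *\<^sub>v u)) (ketbra \<psi>) = sqrt (1 - (cmod (u \<bullet>c (mat_adjoint G *\<^sub>v \<psi>)))\<^sup>2)"
    if "gaussian_unitary_of n Q G" "pure_state n u" for Q G u
  proof -
    have U: "unitary_mat (2 ^ n) G" using that(1) by (simp add: gaussian_unitary_of_def)
    have Gu: "G *\<^sub>v u \<in> carrier_vec (2 ^ n)" "(G *\<^sub>v u) \<bullet>c (G *\<^sub>v u) = 1"
      using unitary_pure_state[OF U that(2)] by (auto simp: pure_state_def)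
    have u: "u \<in> carrier_vec (2 ^ n)" using that(2) by (simp add: pure_state_def)
    show ?thesis
      unfolding trace_distance_ketbra[OF Gu \<psi>] cscalar_prod_adjoint[OF unitary_matD(1)[OF U] u \<psi>(1)] ..
  qed
  have projected: "\<exists>\<phi>. pure_state t \<phi>
      \<and> \<phi> \<otimes>\<^sub>s ket_zeros (n - t) = post_measurement ?P (mat_adjoint G *\<^sub>v \<psi>)
      \<and> compressible_gaussian_state n t (G *\<^sub>v (\<phi> \<otimes>\<^sub>s ket_zeros (n - t)))
      \<and> trace_distance (ketbra (G *\<^sub>v (\<phi> \<otimes>\<^sub>s ket_zeros (n - t)))) (ketbra \<psi>) \<le> sqrt ?S"
    if nfQ: "normal_form n ?C Q lam" and G: "gaussian_unitary_of n Q G"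
      and pos: "outcome_prob ?P (mat_adjoint G *\<^sub>v \<psi>) > 0" for Q G
  proof -
    let ?v = "mat_adjoint G *\<^sub>v \<psi>"
    have v: "?v \<in> carrier_vec (2 ^ n)" using pulled_back[OF G] by (simp add: pure_state_def)
    obtain \<phi> where \<phi>: "pure_state t \<phi>" "\<phi> \<otimes>\<^sub>s ket_zeros (n - t) = post_measurement ?P ?v"
      "post_measurement ?P ?v \<bullet>c ?v = complex_of_real (sqrt (outcome_prob ?P ?v))"
      by (rule post_measurement_zero_projector[OF tn v pos])
    have pure: "pure_state n (\<phi> \<otimes>\<^sub>s ket_zeros (n - t))"
      using \<phi>(1) pure_state_kron_ket_zeros[OF tn] by (simp add: pure_state_def)
    then have "trace_distance (ketbra (G *\<^sub>v (\<phi> \<otimes>\<^sub>s ket_zeros (n - t)))) (ketbra \<psi>)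
        = sqrt (1 - outcome_prob ?P ?v)"
      unfolding dist[OF G pure] unfolding \<phi>(2,3) using pos by (simp add: norm_of_real)
    also have "\<dots> \<le> sqrt ?S" using prob[OF nfQ G] by (intro real_sqrt_le_mono)
    finally show ?thesis using \<phi>(1,2) compr[OF G \<phi>(1)] by blast
  qed
  have "\<exists>\<psi>\<^sub>t. compressible_gaussian_state n t \<psi>\<^sub>t \<and> trace_distance (ketbra \<psi>\<^sub>t) (ketbra \<psi>) \<le> sqrt ?S"
  proof -
    obtain Q where Q: "normal_form n ?C Q lam" using nf by (auto simp: normal_eigenvalues_def)
    obtain G where G: "gaussian_unitary_of n Q G" using G_exists[OF Q] by blast
    show ?thesis
    proof (cases "outcome_prob ?P (mat_adjoint G *\<^sub>v \<psi>) > 0")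
      case True
      from projected[OF Q G True] show ?thesis by blast
    next
      case False
      text \<open>The bound is then at least 1 and holds for every pair of pure states.\<close>
      define u where "u = ket_zeros t \<otimes>\<^sub>s ket_zeros (n - t)"
      have u: "pure_state n u"
        unfolding u_def using ket_zeros_pure[of t] pure_state_kron_ket_zeros[OF tn] by (simp add: pure_state_def)
      have "trace_distance (ketbra (G *\<^sub>v u)) (ketbra \<psi>) \<le> sqrt ?S"
        unfolding dist[OF G u]
        using prob[OF Q G] False zero_le_power2[of "cmod (u \<bullet>c (mat_adjoint G *\<^sub>v \<psi>))"]
        by (intro real_sqrt_le_mono) linarith
      then show ?thesis using compr[OF G ket_zeros_pure] unfolding u_def by blast
    qed
  qed
  then show ?thesis using G_exists projected by blast
qed

end
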